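(* Let $(M,\omega)$ be a closed, connected symplectic manifold and let $\{\phi_t^H\}_{t\in[0,1]}$ be a loop of Hamiltonian diffeomorphisms of $M$ based at the identity, generated by a smooth family of Hamiltonians $H_t$. Then the set of points $x_0\in M$ that are totally degenerate fixed local maxima of $H_t$ is an open subset of $M$.
   Context: $H_t: M\to\mathbb{R}$, $t\in[0,1]$, is a smooth family of functions; $X_t^H$ is defined by $\omega(X_t^H,\cdot)=dH_t$ and $\phi_t^H$ is the corresponding flow with $\phi_0^H=\mathrm{Id}$. It is a loop if $\phi_1^H=\mathrm{Id}$. A point $x_0\in M$ is a fixed local maximum of $H_t$ if there is a neighborhood $U\subset M$ of $x_0$ (the same for all $t$) such that $H_t(x_0)\ge H_t(y)$ for all $t\in[0,1]$ and all $y\in U$. Such a point satisfies $\phi_t^H(x_0)=x_0$ for all $t$. A point $x_0$ with $\phi_t^H(x_0)=x_0$ for all $t$ is totally degenerate if $D\phi_t^H(x_0)=\mathrm{Id}$ for all $t$. *)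

theory Defs
  imports "HOL-Analysis.Analysis"
begin

section \<open>Smooth maps between Euclidean spaces\<close>

primrec Ck_on :: "nat \<Rightarrow> ('a::euclidean_space \<Rightarrow> 'b::euclidean_space) \<Rightarrow> 'a set \<Rightarrow> bool" where
  "Ck_on 0 f S \<longleftrightarrow> continuous_on S f"
| "Ck_on (Suc k) f S \<longleftrightarrow>
     (\<forall>x\<in>S. f differentiable (at x)) \<and> (\<forall>v. Ck_on k (\<lambda>x. frechet_derivative f (at x) v) S)"

text \<open>\<^const>\<open>Ck_on\<close> is only meaningful on open sets. On an arbitrary set, such as
  \<open>{0..1} \<times> V\<close>, smooth means: locally the restriction of a smooth map on an open set.\<close>

definition smooth_on :: "('a::euclidean_space \<Rightarrow> 'b::euclidean_space) \<Rightarrow> 'a set \<Rightarrow> bool" where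
  "smooth_on f S \<longleftrightarrow>
     (\<forall>x\<in>S. \<exists>W g. open W \<and> x \<in> W \<and> (\<forall>k. Ck_on k g W) \<and> (\<forall>y\<in>S \<inter> W. g y = f y))"

section \<open>Smooth manifolds\<close>

text \<open>A chart is a pair of its domain and its coordinate map; the values of the coordinate map
  outside the domain are irrelevant.\<close>

type_synonym ('m, 'e) chart = "'m set \<times> ('m \<Rightarrow> 'e)"

abbreviation chart_dom :: "('m, 'e) chart \<Rightarrow> 'm set" where
  "chart_dom c \<equiv> fst c"

abbreviation chart_map :: "('m, 'e) chart \<Rightarrow> 'm \<Rightarrow> 'e" where
  "chart_map c \<equiv> snd c"

definition chart_inv :: "('m, 'e) chart \<Rightarrow> 'e \<Rightarrow> 'm" where
  "chart_inv c = inv_into (chart_dom c) (chart_map c)"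

definition is_chart :: "('m::topological_space, 'e::euclidean_space) chart \<Rightarrow> bool" where
  "is_chart c \<longleftrightarrow> open (chart_dom c) \<and> open (chart_map c ` chart_dom c) \<and>
     homeomorphism (chart_dom c) (chart_map c ` chart_dom c) (chart_map c) (chart_inv c)"

text \<open>The manifold is the whole type \<open>'m\<close>, and its smooth structure is given by any atlas, not
  necessarily maximal. The notions below quantify over all charts of the atlas; none of them
  changes when the atlas is enlarged by compatible charts.\<close>

definition smooth_atlas ::
  "('m::{t2_space,second_countable_topology}, 'e::euclidean_space) chart set \<Rightarrow> bool" where
  "smooth_atlas A \<longleftrightarrow>
     (\<forall>c\<in>A. is_chart c) \<and> (\<Union>c\<in>A. chart_dom c) = UNIV \<and>
     (\<forall>c\<in>A. \<forall>d\<in>A. smooth_on (chart_map d \<circ> chart_inv c) (chart_map c ` (chart_dom c \<inter> chart_dom d)))"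

definition charts_at :: "('m, 'e) chart set \<Rightarrow> 'm \<Rightarrow> ('m, 'e) chart set" where
  "charts_at A p = {c \<in> A. p \<in> chart_dom c}"

section \<open>Tangent vectors\<close>

text \<open>A tangent vector at \<open>p\<close> is the family of its coordinate representations in the charts
  around \<open>p\<close>, related by the derivatives of the transition maps. The components at all
  other charts are set to zero, so that equality of tangent vectors is equality of functions;
  the vector space operations are pointwise.\<close>

type_synonym ('m, 'e) tvec = "('m, 'e) chart \<Rightarrow> 'e"

definition tangent_space ::
  "('m, 'e::euclidean_space) chart set \<Rightarrow> 'm \<Rightarrow> ('m, 'e) tvec set" where
  "tangent_space A p =
     {v. (\<forall>c\<in>charts_at A p. \<forall>d\<in>charts_at A p.
            v d = frechet_derivative (chart_map d \<circ> chart_inv c) (at (chart_map c p)) (v c)) \<and>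
         (\<forall>c. c \<notin> charts_at A p \<longrightarrow> v c = 0)}"

text \<open>The tangent vector at \<open>p\<close> whose coordinate representation in the chart \<open>c\<close> is \<open>u\<close>.\<close>

definition coord_tvec ::
  "('m, 'e::euclidean_space) chart set \<Rightarrow> ('m, 'e) chart \<Rightarrow> 'm \<Rightarrow> 'e \<Rightarrow> ('m, 'e) tvec" where
  "coord_tvec A c p u =
     (\<lambda>d. if d \<in> charts_at A p
           then frechet_derivative (chart_map d \<circ> chart_inv c) (at (chart_map c p)) u else 0)"

definition has_velocity ::
  "('m::t2_space, 'e::euclidean_space) chart set \<Rightarrow> (real \<Rightarrow> 'm) \<Rightarrow> ('m, 'e) tvec \<Rightarrow> real \<Rightarrow> real set \<Rightarrow> bool"
  where
  "has_velocity A \<gamma> v t T \<longleftrightarrow>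
     v \<in> tangent_space A (\<gamma> t) \<and> continuous (at t within T) \<gamma> \<and>
     (\<forall>c\<in>charts_at A (\<gamma> t). ((chart_map c \<circ> \<gamma>) has_vector_derivative v c) (at t within T))"

text \<open>\<open>f\<close> is differentiable at \<open>p\<close> and its differential on the tangent space at \<open>p\<close> is \<open>L\<close>;
  first for real functions, then for maps of the manifold to itself. Continuity at \<open>p\<close>
  ensures that \<open>f\<close> maps a neighbourhood of \<open>p\<close> into the domain of a given chart at \<open>f p\<close>.\<close>

definition has_differential_fun ::
  "('m, 'e::euclidean_space) chart set \<Rightarrow> ('m \<Rightarrow> real) \<Rightarrow> 'm \<Rightarrow> (('m, 'e) tvec \<Rightarrow> real) \<Rightarrow> bool" where
  "has_differential_fun A f p L \<longleftrightarrow>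
     (\<forall>c\<in>charts_at A p.
        ((f \<circ> chart_inv c) has_derivative (\<lambda>u. L (coord_tvec A c p u))) (at (chart_map c p)))"

definition has_differential_map ::
  "('m::t2_space, 'e::euclidean_space) chart set \<Rightarrow> ('m \<Rightarrow> 'm) \<Rightarrow> 'm \<Rightarrow>
     (('m, 'e) tvec \<Rightarrow> ('m, 'e) tvec) \<Rightarrow> bool" where
  "has_differential_map A f p L \<longleftrightarrow>
     isCont f p \<and> (\<forall>v\<in>tangent_space A p. L v \<in> tangent_space A (f p)) \<and>
     (\<forall>c\<in>charts_at A p. \<forall>d\<in>charts_at A (f p).
        ((chart_map d \<circ> f \<circ> chart_inv c) has_derivative (\<lambda>u. L (coord_tvec A c p u) d))
          (at (chart_map c p)))"

section \<open>Symplectic forms\<close>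

type_synonym ('m, 'e) two_form = "'m \<Rightarrow> ('m, 'e) tvec \<Rightarrow> ('m, 'e) tvec \<Rightarrow> real"

text \<open>The coordinate expression of a 2-form in the chart \<open>c\<close>.\<close>

definition coord_form ::
  "('m, 'e::euclidean_space) chart set \<Rightarrow> ('m, 'e) two_form \<Rightarrow> ('m, 'e) chart \<Rightarrow>
     'e \<Rightarrow> 'e \<Rightarrow> 'e \<Rightarrow> real" where
  "coord_form A \<omega> c x u v =
     (let p = chart_inv c x in \<omega> p (coord_tvec A c p u) (coord_tvec A c p v))"

definition smooth_two_form ::
  "('m, 'e::euclidean_space) chart set \<Rightarrow> ('m, 'e) two_form \<Rightarrow> bool" where
  "smooth_two_form A \<omega> \<longleftrightarrow>
     (\<forall>p. \<forall>u\<in>tangent_space A p. \<forall>v\<in>tangent_space A p. \<forall>w\<in>tangent_space A p. \<forall>a b.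
        \<omega> p (\<lambda>c. a *\<^sub>R u c + b *\<^sub>R v c) w = a * \<omega> p u w + b * \<omega> p v w) \<and>
     (\<forall>p. \<forall>u\<in>tangent_space A p. \<forall>v\<in>tangent_space A p. \<omega> p u v = - \<omega> p v u) \<and>
     (\<forall>c\<in>A. \<forall>u v. smooth_on (\<lambda>x. coord_form A \<omega> c x u v) (chart_map c ` chart_dom c))"

text \<open>\<open>d\<omega> = 0\<close>, with \<open>d\<omega>\<close> evaluated in coordinates on constant vector fields \<open>u\<close>, \<open>v\<close>, \<open>w\<close>:
  \<open>d\<omega>(u,v,w) = \<partial>\<^sub>u \<omega>(v,w) + \<partial>\<^sub>v \<omega>(w,u) + \<partial>\<^sub>w \<omega>(u,v)\<close>.\<close>

definition closed_two_form ::
  "('m, 'e::euclidean_space) chart set \<Rightarrow> ('m, 'e) two_form \<Rightarrow> bool" where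
  "closed_two_form A \<omega> \<longleftrightarrow>
     (\<forall>c\<in>A. \<forall>x\<in>chart_map c ` chart_dom c. \<forall>u v w.
        frechet_derivative (\<lambda>y. coord_form A \<omega> c y v w) (at x) u +
        frechet_derivative (\<lambda>y. coord_form A \<omega> c y w u) (at x) v +
        frechet_derivative (\<lambda>y. coord_form A \<omega> c y u v) (at x) w = 0)"

definition nondegenerate_two_form ::
  "('m, 'e::euclidean_space) chart set \<Rightarrow> ('m, 'e) two_form \<Rightarrow> bool" where
  "nondegenerate_two_form A \<omega> \<longleftrightarrow>
     (\<forall>p. \<forall>v\<in>tangent_space A p. (\<forall>w\<in>tangent_space A p. \<omega> p v w = 0) \<longrightarrow> v = (\<lambda>_. 0))"

definition symplectic_form ::
  "('m, 'e::euclidean_space) chart set \<Rightarrow> ('m, 'e) two_form \<Rightarrow> bool" where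
  "symplectic_form A \<omega> \<longleftrightarrow>
     smooth_two_form A \<omega> \<and> closed_two_form A \<omega> \<and> nondegenerate_two_form A \<omega>"

section \<open>Hamiltonian flows\<close>

definition smooth_family ::
  "('m, 'e::euclidean_space) chart set \<Rightarrow> (real \<Rightarrow> 'm \<Rightarrow> real) \<Rightarrow> bool" where
  "smooth_family A H \<longleftrightarrow>
     (\<forall>c\<in>A. smooth_on (\<lambda>(t, x). H t (chart_inv c x)) ({0..1} \<times> chart_map c ` chart_dom c))"

text \<open>\<open>X\<close> is the vector field with \<open>\<omega>(X,\<cdot>) = dh\<close>, unique by nondegeneracy of \<open>\<omega>\<close>.\<close>

definition hamiltonian_vector_field ::
  "('m, 'e::euclidean_space) chart set \<Rightarrow> ('m, 'e) two_form \<Rightarrow> ('m \<Rightarrow> real) \<Rightarrow>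
     ('m \<Rightarrow> ('m, 'e) tvec) \<Rightarrow> bool" where
  "hamiltonian_vector_field A \<omega> h X \<longleftrightarrow>
     (\<forall>p. X p \<in> tangent_space A p \<and> has_differential_fun A h p (\<omega> p (X p)))"

text \<open>The flow is determined by its integral curves. Its smoothness and the invertibility of the
  time \<open>t\<close> maps follow from the theory of ordinary differential equations and are not part of the
  definition. At the endpoints of \<open>{0..1}\<close> the velocities are one-sided.\<close>

definition flow_of ::
  "('m::t2_space, 'e::euclidean_space) chart set \<Rightarrow> (real \<Rightarrow> 'm \<Rightarrow> ('m, 'e) tvec) \<Rightarrow>
     (real \<Rightarrow> 'm \<Rightarrow> 'm) \<Rightarrow> bool" where
  "flow_of A X \<phi> \<longleftrightarrow>
     (\<forall>x. \<phi> 0 x = x) \<and>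
     (\<forall>x. \<forall>t\<in>{0..1}. has_velocity A (\<lambda>s. \<phi> s x) (X t (\<phi> t x)) t {0..1})"

definition hamiltonian_flow ::
  "('m::t2_space, 'e::euclidean_space) chart set \<Rightarrow> ('m, 'e) two_form \<Rightarrow>
     (real \<Rightarrow> 'm \<Rightarrow> real) \<Rightarrow> (real \<Rightarrow> 'm \<Rightarrow> 'm) \<Rightarrow> bool" where
  "hamiltonian_flow A \<omega> H \<phi> \<longleftrightarrow>
     (\<exists>X. (\<forall>t\<in>{0..1}. hamiltonian_vector_field A \<omega> (H t) (X t)) \<and> flow_of A X \<phi>)"

definition is_loop :: "(real \<Rightarrow> 'm \<Rightarrow> 'm) \<Rightarrow> bool" where
  "is_loop \<phi> \<longleftrightarrow> (\<forall>x. \<phi> 1 x = x)"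

definition fixed_local_max :: "(real \<Rightarrow> 'm::topological_space \<Rightarrow> real) \<Rightarrow> 'm \<Rightarrow> bool" where
  "fixed_local_max H x\<^sub>0 \<longleftrightarrow>
     (\<exists>U. open U \<and> x\<^sub>0 \<in> U \<and> (\<forall>t\<in>{0..1}. \<forall>y\<in>U. H t y \<le> H t x\<^sub>0))"

definition totally_degenerate ::
  "('m::t2_space, 'e::euclidean_space) chart set \<Rightarrow> (real \<Rightarrow> 'm \<Rightarrow> 'm) \<Rightarrow> 'm \<Rightarrow> bool" where
  "totally_degenerate A \<phi> x\<^sub>0 \<longleftrightarrow>
     (\<forall>t\<in>{0..1}. \<phi> t x\<^sub>0 = x\<^sub>0) \<and>
     (\<forall>t\<in>{0..1}. has_differential_map A (\<phi> t) x\<^sub>0 (\<lambda>v. v))"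

end

theory Submission
  imports Defs
begin

text \<open>Around a totally degenerate fixed maximum \<open>x\<^sub>0\<close> the loop is the identity and \<open>H\<^sub>t\<close> is constant
  in space. This local rigidity gives openness at once: every nearby point is again a maximum of
  the same value, and the flow fixes a whole neighbourhood of it.

  The argument takes place in a chart around \<open>x\<^sub>0\<close>, on a small ball with centre \<open>p\<close>. There the
  symplectic form is exact, \<open>\<Omega> = d\<lambda>\<close>, by the Poincare lemma (\<open>poincare_two_form\<close>). Every
  point \<open>x\<close> near \<open>p\<close> moves along a closed orbit \<open>\<Gamma>\<^sub>x\<close> that stays in the ball. A closed orbit is a
  critical point of the action \<open>\<integral> \<lambda>(\<gamma>) \<gamma>' + h\<^sub>t(\<gamma>) dt\<close> on the space of loops. The orbits depend on
  \<open>x\<close> in a Lipschitz way, so the action of \<open>\<Gamma>\<^sub>x\<close> has zero derivative in \<open>x\<close> and is constant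
  (\<open>action_deriv\<close>). Comparison with the constant orbit at \<open>p\<close> gives, for the nonnegative
  functions \<open>f\<^sub>t = h\<^sub>t(p) - h\<^sub>t\<close>,
  \<open>\<integral> f\<^sub>t(\<Gamma>\<^sub>x(t)) dt = \<integral> \<lambda>(\<Gamma>\<^sub>x) \<Gamma>\<^sub>x' dt\<close> (\<open>action_eq\<close>).

  The right-hand side is the symplectic area of a loop, hence at most a constant times the square
  of its length, hence at most a constant times \<open>\<integral> |\<nabla>f\<^sub>t(\<Gamma>\<^sub>x(t))|\<^sup>2 dt\<close>. Total degeneracy forces
  the Hessian of \<open>h\<^sub>t\<close> at \<open>p\<close> to vanish (\<open>hessian_eq_0\<close>), so \<open>\<nabla>f\<^sub>t\<close> has an arbitrarily small
  Lipschitz constant \<open>\<epsilon>\<close> near \<open>p\<close>, and a nonnegative function with such a gradient satisfies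
  \<open>|\<nabla>f\<^sub>t|\<^sup>2 \<le> 4 \<epsilon> f\<^sub>t\<close> (\<open>norm_gradient_squared_le\<close>). For small \<open>\<epsilon>\<close> these bounds give
  \<open>\<integral> f\<^sub>t(\<Gamma>\<^sub>x) \<le> 1/2 \<integral> f\<^sub>t(\<Gamma>\<^sub>x)\<close>. Therefore \<open>f\<^sub>t\<close> vanishes along \<open>\<Gamma>\<^sub>x\<close>, the velocity
  vanishes as well, and the orbit is a point.

  Flows are only given through their integral curves. All dependence on the initial point is
  therefore derived from the differential inequality in \<open>norm_le_exp_mult_norm\<close>; differentiability
  of the flow is available only at \<open>x\<^sub>0\<close> itself, where total degeneracy provides it.\<close>

section \<open>Uniform estimates in calculus\<close>

text \<open>Gronwall's inequality for curves: \<open>exp (- 2 L t) |z t|\<^sup>2\<close> has a nonpositive derivative. It yields both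
  the confinement of orbits and their Lipschitz dependence on the initial point.\<close>

lemma norm_le_exp_mult_norm:
  fixes z :: "real \<Rightarrow> 'e::real_inner"
  assumes z: "\<And>t. t \<in> {0..b} \<Longrightarrow> (z has_vector_derivative z' t) (at t within {0..b})"
    and le: "\<And>t. t \<in> {0..b} \<Longrightarrow> norm (z' t) \<le> L * norm (z t)"
    and t: "t \<in> {0..b}"
  shows "norm (z t) \<le> exp (L * t) * norm (z 0)"
proof (cases "t = 0")
  case True
  then show ?thesis by simp
next
  case False
  with t have t0: "0 < t" by auto
  define q where "q s = exp (- (2 * L * s)) * (z s \<bullet> z s)" for s
  have q: "(q has_vector_derivative exp (- (2 * L * s)) * (2 * (z s \<bullet> z' s) - 2 * L * (z s \<bullet> z s)))
      (at s within {0..b})" if "s \<in> {0..b}" for s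
    using z[OF that] unfolding q_def has_vector_derivative_def
    by (auto intro!: derivative_eq_intros simp: algebra_simps inner_commute)
  have "q t \<le> q 0"
  proof (rule DERIV_nonpos_imp_decreasing_open[OF less_imp_le[OF t0]])
    fix s assume s: "0 < s" "s < t"
    then have "s \<in> {0..b}" and s': "s \<in> {0<..<b}" using t by auto
    have "at s within {0..b} = at s"
      by (rule at_within_interior) (use s' in \<open>simp add: interior_atLeastAtMost_real\<close>)
    with q[OF \<open>s \<in> {0..b}\<close>] have "DERIV q s :> exp (- (2 * L * s)) * (2 * (z s \<bullet> z' s) - 2 * L * (z s \<bullet> z s))"
      by (simp add: has_real_derivative_iff_has_vector_derivative)
    moreover have "z s \<bullet> z' s \<le> L * (z s \<bullet> z s)"
    proof -
      have "z s \<bullet> z' s \<le> norm (z s) * norm (z' s)" by (rule norm_cauchy_schwarz)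
      also have "\<dots> \<le> norm (z s) * (L * norm (z s))"
        by (intro mult_left_mono le[OF \<open>s \<in> {0..b}\<close>]) auto
      finally show ?thesis by (simp add: power2_norm_eq_inner[symmetric] power2_eq_square mult.left_commute)
    qed
    ultimately show "\<exists>y. DERIV q s :> y \<and> y \<le> 0"
      by (fastforce intro: mult_nonneg_nonpos)
  next
    have "continuous_on {0..b} q"
      by (rule continuous_on_vector_derivative) (rule q)
    then show "continuous_on {0..t} q"
      by (rule continuous_on_subset) (use t in auto)
  qed
  then have "exp (- (2 * L * t)) * (norm (z t))\<^sup>2 \<le> (norm (z 0))\<^sup>2"
    by (simp add: q_def power2_norm_eq_inner)
  then have "exp (2 * L * t) * (exp (- (2 * L * t)) * (norm (z t))\<^sup>2) \<le> exp (2 * L * t) * (norm (z 0))\<^sup>2"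
    by (rule mult_left_mono) simp
  then have "(norm (z t))\<^sup>2 \<le> exp (2 * L * t) * (norm (z 0))\<^sup>2"
    by (simp add: mult.assoc[symmetric] mult_exp_exp)
  also have "\<dots> = (exp (L * t) * norm (z 0))\<^sup>2"
    using exp_double[of "L * t"] by (simp add: power_mult_distrib mult.assoc)
  finally show ?thesis
    by (rule power2_le_imp_le) simp
qed

lemma linear_norm_le_sum_Basis:
  fixes f :: "'e::euclidean_space \<Rightarrow> 'b::real_normed_vector"
  assumes "linear f"
  shows "norm (f u) \<le> (\<Sum>i\<in>Basis. norm (f i)) * norm u"
proof -
  have "f u = f (\<Sum>i\<in>Basis. (u \<bullet> i) *\<^sub>R i)" by (simp add: euclidean_representation)
  also have "\<dots> = (\<Sum>i\<in>Basis. (u \<bullet> i) *\<^sub>R f i)"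
    using assms by (simp add: linear_sum linear_scale)
  finally have "norm (f u) \<le> (\<Sum>i\<in>Basis. norm ((u \<bullet> i) *\<^sub>R f i))"
    by (metis norm_sum)
  also have "\<dots> \<le> (\<Sum>i\<in>Basis. norm (f i) * norm u)"
  proof (rule sum_mono)
    fix i :: 'e assume "i \<in> Basis"
    then show "norm ((u \<bullet> i) *\<^sub>R f i) \<le> norm (f i) * norm u"
      using mult_left_mono[OF Basis_le_norm[of i u], of "norm (f i)"] by (simp add: mult.commute)
  qed
  finally show ?thesis by (simp add: sum_distrib_right)
qed

lemma bounded_on_compact_times:
  assumes "compact T" "compact K" "continuous_on (T \<times> K) (\<lambda>(t, x). F t x)"
  obtains M :: real where "M \<ge> 0" "\<And>t x. t \<in> T \<Longrightarrow> x \<in> K \<Longrightarrow> norm (F t x) \<le> M"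
proof -
  have "bounded ((\<lambda>(t, x). F t x) ` (T \<times> K))"
    by (intro compact_imp_bounded compact_continuous_image assms compact_Times)
  then obtain M where "\<forall>y\<in>(\<lambda>(t, x). F t x) ` (T \<times> K). norm y \<le> M"
    unfolding bounded_iff by blast
  then have M: "norm (F t x) \<le> M" if "t \<in> T" "x \<in> K" for t x
    using that by auto
  show ?thesis
    by (rule that[of "max 0 M"]) (use M in \<open>auto intro: max.coboundedI2\<close>)
qed

lemma continuous_on_slice:
  assumes "continuous_on (A \<times> B) (\<lambda>(x, y). F x y)" "x \<in> A"
  shows "continuous_on B (F x)"
proof -
  have "continuous_on B (\<lambda>y. (\<lambda>(x, y). F x y) (x, y))"
    by (rule continuous_on_compose2[OF assms(1)]) (use assms(2) in \<open>auto intro!: continuous_intros\<close>)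
  then show ?thesis by simp
qed

lemma norm_diff_le_linear_approximation:
  fixes f :: "'e::euclidean_space \<Rightarrow> 'b::real_normed_vector"
  assumes "convex K" "x \<in> K" "y \<in> K"
    and f: "\<And>w. w \<in> K \<Longrightarrow> (f has_derivative f' w) (at w within K)"
    and l: "bounded_linear l"
    and le: "\<And>w u. w \<in> closed_segment x y \<Longrightarrow> norm (f' w u - l u) \<le> B * norm u"
  shows "norm (f y - f x - l (y - x)) \<le> B * norm (y - x)"
proof -
  have sub: "closed_segment x y \<subseteq> K"
    using assms by (simp add: closed_segment_subset)
  have "norm ((f y - l y) - (f x - l x)) \<le> B * norm (y - x)"
  proof (rule differentiable_bound[where S = "closed_segment x y"])
    show "((\<lambda>w. f w - l w) has_derivative (\<lambda>u. f' w u - l u)) (at w within closed_segment x y)"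
      if "w \<in> closed_segment x y" for w
      using that sub by (intro has_derivative_diff has_derivative_subset[OF f] bounded_linear_imp_has_derivative l) auto
    show "onorm (\<lambda>u. f' w u - l u) \<le> B" if "w \<in> closed_segment x y" for w
      by (rule onorm_le) (rule le[OF that])
  qed auto
  then show ?thesis
    by (simp add: linear_diff[OF bounded_linear.linear[OF l]] algebra_simps)
qed

text \<open>The error of the first-order expansion is small uniformly in the base point and in the parameter,
  because the derivative is uniformly continuous on a compact set. Plain differentiability would not
  do here: the expansion is later integrated along orbits, with the base point moving in \<open>K\<close>.\<close>

lemma uniform_taylor:
  fixes f :: "'t::metric_space \<Rightarrow> 'e::euclidean_space \<Rightarrow> 'b::real_normed_vector"
  assumes cpt: "compact T" "compact K" and "convex K"
    and f: "\<And>t x. t \<in> T \<Longrightarrow> x \<in> K \<Longrightarrow> (f t has_derivative f' t x) (at x within K)"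
    and cont: "\<And>u. continuous_on (T \<times> K) (\<lambda>(t, x). f' t x u)"
    and "e > 0"
  obtains d where "d > 0" "\<And>t x y. t \<in> T \<Longrightarrow> x \<in> K \<Longrightarrow> y \<in> K \<Longrightarrow> dist x y < d \<Longrightarrow>
      norm (f t y - f t x - f' t x (y - x)) \<le> e * norm (y - x)"
proof -
  let ?n = "real DIM('e)"
  have "\<forall>i\<in>(Basis::'e set). eventually (\<lambda>d. \<forall>t\<in>T. \<forall>x\<in>K. \<forall>y\<in>K. dist x y < d \<longrightarrow>
      norm (f' t y i - f' t x i) \<le> e / ?n) (at_right (0::real))"
  proof
    fix i :: 'e assume "i \<in> Basis"
    have "uniformly_continuous_on (T \<times> K) (\<lambda>(t, x). f' t x i)"
      by (intro compact_uniformly_continuous cont compact_Times cpt)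
    then obtain d where "d > 0" and d: "\<And>z z'. z \<in> T \<times> K \<Longrightarrow> z' \<in> T \<times> K \<Longrightarrow> dist z' z < d \<Longrightarrow>
        dist (case z' of (t, x) \<Rightarrow> f' t x i) (case z of (t, x) \<Rightarrow> f' t x i) < e / ?n"
      unfolding uniformly_continuous_on_def using \<open>e > 0\<close>
      by (elim allE[of _ "e / ?n"]) auto
    have "norm (f' t y i - f' t x i) \<le> e / ?n" if "t \<in> T" "x \<in> K" "y \<in> K" "dist x y < d" for t x y
      using d[of "(t, x)" "(t, y)"] that by (simp add: dist_Pair_Pair dist_norm norm_minus_commute)
    then show "eventually (\<lambda>d. \<forall>t\<in>T. \<forall>x\<in>K. \<forall>y\<in>K. dist x y < d \<longrightarrow>
      norm (f' t y i - f' t x i) \<le> e / ?n) (at_right (0::real))"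
      unfolding eventually_at_right_field using \<open>d > 0\<close> by (intro exI[of _ d]) auto
  qed
  then have "eventually (\<lambda>d. \<forall>i\<in>(Basis::'e set). \<forall>t\<in>T. \<forall>x\<in>K. \<forall>y\<in>K. dist x y < d \<longrightarrow>
      norm (f' t y i - f' t x i) \<le> e / ?n) (at_right (0::real))"
    by (intro eventually_ball_finite) auto
  then obtain b where "b > 0" and b: "\<forall>d>0. d < b \<longrightarrow> (\<forall>i\<in>(Basis::'e set). \<forall>t\<in>T. \<forall>x\<in>K. \<forall>y\<in>K.
      dist x y < d \<longrightarrow> norm (f' t y i - f' t x i) \<le> e / ?n)"
    unfolding eventually_at_right_field by blast
  define d where "d = b / 2"
  have "d > 0" "d < b" using \<open>b > 0\<close> by (auto simp: d_def)
  with b have d: "norm (f' t y i - f' t x i) \<le> e / ?n"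
    if "i \<in> Basis" "t \<in> T" "x \<in> K" "y \<in> K" "dist x y < d" for i t x y
    using that by blast
  show ?thesis
  proof (rule that[OF \<open>d > 0\<close>])
    fix t x y assume t: "t \<in> T" and xy: "x \<in> K" "y \<in> K" "dist x y < d"
    have lin: "bounded_linear (f' t w)" if "w \<in> K" for w
      using f[OF t that] by (rule has_derivative_bounded_linear)
    show "norm (f t y - f t x - f' t x (y - x)) \<le> e * norm (y - x)"
    proof (rule norm_diff_le_linear_approximation[where l = "f' t x" and f = "f t" and f' = "f' t",
          OF \<open>convex K\<close> xy(1,2) f[OF t] lin[OF xy(1)]])
      fix w u assume w: "w \<in> closed_segment x y"
      then have "w \<in> K"
        using closed_segment_subset[OF xy(1,2) \<open>convex K\<close>] by auto
      have "dist x w < d"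
        using w xy(3) segment_bound(1)[OF w] by (simp add: dist_norm norm_minus_commute)
      have "linear (\<lambda>u. f' t w u - f' t x u)"
        by (intro bounded_linear.linear bounded_linear_sub lin xy \<open>w \<in> K\<close>)
      then have "norm (f' t w u - f' t x u) \<le> (\<Sum>i\<in>Basis. norm (f' t w i - f' t x i)) * norm u"
        by (rule linear_norm_le_sum_Basis)
      also have "\<dots> \<le> (\<Sum>i\<in>(Basis::'e set). e / ?n) * norm u"
        using d t xy \<open>w \<in> K\<close> \<open>dist x w < d\<close> by (intro mult_right_mono sum_mono) auto
      finally show "norm (f' t w u - f' t x u) \<le> e * norm u" by simp
    qed
  qed
qed

lemma uniform_lipschitz:
  fixes f :: "'t::metric_space \<Rightarrow> 'e::euclidean_space \<Rightarrow> 'b::real_normed_vector"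
  assumes "convex K"
    and f: "\<And>t x. t \<in> T \<Longrightarrow> x \<in> K \<Longrightarrow> (f t has_derivative f' t x) (at x within K)"
    and le: "\<And>t x. t \<in> T \<Longrightarrow> x \<in> K \<Longrightarrow> (\<Sum>i\<in>Basis. norm (f' t x i)) \<le> B"
    and "t \<in> T" "x \<in> K" "y \<in> K"
  shows "norm (f t x - f t y) \<le> B * norm (x - y)"
proof (rule differentiable_bound[OF \<open>convex K\<close> f[OF \<open>t \<in> T\<close>]])
  fix w assume w: "w \<in> K"
  have "linear (f' t w)"
    using f[OF \<open>t \<in> T\<close> w] by (intro bounded_linear.linear has_derivative_bounded_linear)
  then have "norm (f' t w u) \<le> B * norm u" for u
    using linear_norm_le_sum_Basis[of "f' t w" u] le[OF \<open>t \<in> T\<close> w]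
    by (meson mult_right_mono norm_ge_zero order_trans)
  then show "onorm (f' t w) \<le> B" by (rule onorm_le)
qed (use assms in auto)

lemma lipschitz_on_compact:
  fixes f :: "'t::metric_space \<Rightarrow> 'e::euclidean_space \<Rightarrow> 'b::real_normed_vector"
  assumes cpt: "compact T" "compact K" and "convex K"
    and f: "\<And>t x. t \<in> T \<Longrightarrow> x \<in> K \<Longrightarrow> (f t has_derivative f' t x) (at x within K)"
    and cont: "\<And>u. continuous_on (T \<times> K) (\<lambda>(t, x). f' t x u)"
  obtains B where "B \<ge> 0"
    "\<And>t x y. t \<in> T \<Longrightarrow> x \<in> K \<Longrightarrow> y \<in> K \<Longrightarrow> norm (f t x - f t y) \<le> B * norm (x - y)"
proof -
  have "continuous_on (T \<times> K) (\<lambda>(t, x). \<Sum>i\<in>Basis. norm (f' t x i))"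
    using cont unfolding case_prod_beta by (intro continuous_intros) auto
  from bounded_on_compact_times[OF cpt this]
  obtain B where "B \<ge> 0" and B: "\<And>t x. t \<in> T \<Longrightarrow> x \<in> K \<Longrightarrow> norm (\<Sum>i\<in>Basis. norm (f' t x i)) \<le> B"
    by blast
  show ?thesis
  proof (rule that[OF \<open>B \<ge> 0\<close>])
    fix t x y assume "t \<in> T" "x \<in> K" "y \<in> K"
    then show "norm (f t x - f t y) \<le> B * norm (x - y)"
      using B by (intro uniform_lipschitz[OF \<open>convex K\<close> f]) (auto dest: abs_le_D1)
  qed
qed

text \<open>A nonnegative function cannot decrease below zero along a gradient step. The step of length
  \<open>|g y| / (2 \<epsilon>)\<close> lowers \<open>f\<close> by at least \<open>|g y|\<^sup>2 / (4 \<epsilon>)\<close>, since the gradient hardly changes on the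
  way. The critical point \<open>p\<close> guarantees that the step stays in the ball.\<close>

lemma norm_gradient_squared_le:
  fixes f :: "'e::euclidean_space \<Rightarrow> real"
  assumes "\<epsilon> > 0"
    and f: "\<And>x. x \<in> cball p \<rho> \<Longrightarrow> (f has_derivative (\<lambda>u. g x \<bullet> u)) (at x within cball p \<rho>)"
    and nonneg: "\<And>x. x \<in> cball p \<rho> \<Longrightarrow> 0 \<le> f x"
    and lip: "\<And>x y. x \<in> cball p \<rho> \<Longrightarrow> y \<in> cball p \<rho> \<Longrightarrow> norm (g x - g y) \<le> \<epsilon> * norm (x - y)"
    and "g p = 0" and y: "y \<in> cball p (\<rho> / 2)"
  shows "(norm (g y))\<^sup>2 \<le> 4 * \<epsilon> * f y"
proof -
  have "0 \<le> \<rho> / 2" using y by (meson dist_not_less_zero le_less_trans mem_cball not_le)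
  then have y': "y \<in> cball p \<rho>" and p: "p \<in> cball p \<rho>" using y by auto
  define w where "w = y - (1 / (2 * \<epsilon>)) *\<^sub>R g y"
  have "norm (g y) \<le> \<epsilon> * norm (y - p)"
    using lip[OF y' p] \<open>g p = 0\<close> by simp
  also have "\<dots> \<le> \<epsilon> * (\<rho> / 2)"
    using y \<open>\<epsilon> > 0\<close> by (intro mult_left_mono) (auto simp: dist_norm norm_minus_commute)
  finally have "dist y w \<le> \<rho> / 4"
    using \<open>\<epsilon> > 0\<close> by (simp add: w_def dist_norm field_simps)
  moreover have "dist p w \<le> dist p y + dist y w" by (rule dist_triangle)
  moreover have "dist p y \<le> \<rho> / 2" using y by simp
  ultimately have "dist p w \<le> \<rho>" using \<open>0 \<le> \<rho> / 2\<close> by linarith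
  then have w: "w \<in> cball p \<rho>" by simp
  have "norm (g v \<bullet> u - g y \<bullet> u) \<le> (\<epsilon> * norm (w - y)) * norm u"
    if v: "v \<in> closed_segment y w" for v u
  proof -
    have v': "v \<in> cball p \<rho>"
      using v closed_segment_subset[OF y' w convex_cball] by blast
    have "norm (g v \<bullet> u - g y \<bullet> u) \<le> norm (g v - g y) * norm u"
      using Cauchy_Schwarz_ineq2[of "g v - g y" u] by (simp add: inner_diff_left)
    also have "\<dots> \<le> (\<epsilon> * norm (w - y)) * norm u"
    proof (rule mult_right_mono)
      have "norm (g v - g y) \<le> \<epsilon> * norm (v - y)" by (rule lip[OF v' y'])
      also have "\<dots> \<le> \<epsilon> * norm (w - y)"
        using segment_bound(1)[OF v] \<open>\<epsilon> > 0\<close> by (intro mult_left_mono) auto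
      finally show "norm (g v - g y) \<le> \<epsilon> * norm (w - y)" .
    qed simp
    finally show ?thesis .
  qed
  with f have "norm (f w - f y - g y \<bullet> (w - y)) \<le> (\<epsilon> * norm (w - y)) * norm (w - y)"
    by (intro norm_diff_le_linear_approximation[where l = "\<lambda>u. g y \<bullet> u" and f' = "\<lambda>v u. g v \<bullet> u",
        OF convex_cball y' w] bounded_linear_inner_right)
  moreover have "g y \<bullet> (w - y) = - (norm (g y))\<^sup>2 / (2 * \<epsilon>)"
    by (simp add: w_def power2_norm_eq_inner)
  moreover have "(\<epsilon> * norm (w - y)) * norm (w - y) = (norm (g y))\<^sup>2 / (4 * \<epsilon>)"
    using \<open>\<epsilon> > 0\<close> by (simp add: w_def field_simps power2_eq_square)
  ultimately have "0 \<le> f y - (norm (g y))\<^sup>2 / (2 * \<epsilon>) + (norm (g y))\<^sup>2 / (4 * \<epsilon>)"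
    using nonneg[OF w] by (simp add: abs_le_iff) 
  then show ?thesis using \<open>\<epsilon> > 0\<close> by (simp add: field_simps)
qed

text \<open>The Cauchy-Schwarz inequality against the constant function 1: the variance of \<open>g\<close> is nonnegative.\<close>

lemma integral_power2_le:
  fixes g :: "real \<Rightarrow> real"
  assumes g: "continuous_on {0..1} g"
  shows "(integral {0..1} g)\<^sup>2 \<le> integral {0..1} (\<lambda>t. (g t)\<^sup>2)"
proof -
  let ?m = "integral {0..1} g"
  have i: "g integrable_on {0..1}" "(\<lambda>t. (g t)\<^sup>2) integrable_on {0..1}"
    by (intro integrable_continuous_interval continuous_intros g)+
  have "((\<lambda>t. (g t)\<^sup>2 - 2 * ?m * g t + ?m\<^sup>2) has_integral
      integral {0..1} (\<lambda>t. (g t)\<^sup>2) - 2 * ?m * ?m + ?m\<^sup>2) {0..1}"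
    using has_integral_const_real[of "?m\<^sup>2" 0 1]
    by (intro has_integral_add has_integral_diff has_integral_mult_right integrable_integral i) simp
  then have "0 \<le> integral {0..1} (\<lambda>t. (g t)\<^sup>2) - 2 * ?m * ?m + ?m\<^sup>2"
  proof (rule has_integral_nonneg)
    show "0 \<le> (g t)\<^sup>2 - 2 * ?m * g t + ?m\<^sup>2" for t
      using zero_le_power2[of "g t - ?m"] by (simp add: power2_eq_square algebra_simps)
  qed
  then show ?thesis by (simp add: power2_eq_square)
qed

text \<open>A first-exit argument: at the first time outside \<open>U\<close> the curve is a limit of points of the closed
  set \<open>K\<close>, hence still inside \<open>U\<close>. The a priori estimate \<open>step\<close> may use that the curve has been in
  \<open>U\<close> up to the time in question.\<close>

lemma stays_inside:
  fixes g :: "real \<Rightarrow> 'm::topological_space"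
  assumes g: "continuous_on {0..1} g" and U: "open U" "g 0 \<in> U" and K: "closed K" "K \<subseteq> U"
    and step: "\<And>t. t \<in> {0..1} \<Longrightarrow> g ` {0..t} \<subseteq> U \<Longrightarrow> g t \<in> K"
    and t: "t \<in> {0..1}"
  shows "g t \<in> U"
proof (rule ccontr)
  assume "g t \<notin> U"
  define B where "B = {0..1} \<inter> g -` (- U)"
  have B: "closed B"
    unfolding B_def using g closed_atLeastAtMost closed_Compl[of U] U(1) by (intro continuous_closed_preimage) auto
  have "B \<noteq> {}" using t \<open>g t \<notin> U\<close> by (auto simp: B_def)
  moreover have bdd: "bdd_below B" unfolding B_def by (intro bdd_belowI[of _ 0]) auto
  ultimately have b: "Inf B \<in> B" by (rule closed_contains_Inf[OF _ _ B])
  define b where "b = Inf B"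
  have "b \<in> {0..1}" "g b \<notin> U" using b by (auto simp: B_def b_def)
  then have "0 < b" using U(2) by (cases "b = 0") auto
  have before: "g s \<in> U" if "s \<in> {0..<b}" for s
  proof (rule ccontr)
    assume "g s \<notin> U"
    then have "s \<in> B" using that \<open>b \<in> {0..1}\<close> by (auto simp: B_def)
    from cInf_lower[OF this bdd] show False using that by (simp add: b_def)
  qed
  have "closed ({0..1} \<inter> g -` K)"
    by (intro continuous_closed_preimage g closed_atLeastAtMost K)
  moreover have "{0..<b} \<subseteq> {0..1} \<inter> g -` K"
  proof
    fix s assume s: "s \<in> {0..<b}"
    then have "s \<in> {0..1}" using \<open>b \<in> {0..1}\<close> by auto
    moreover have "g ` {0..s} \<subseteq> U" using before s by auto
    ultimately show "s \<in> {0..1} \<inter> g -` K" using step by auto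
  qed
  ultimately have "closure {0..<b} \<subseteq> {0..1} \<inter> g -` K" by (rule closure_minimal[rotated])
  moreover have "b \<in> closure {0..<b}" using \<open>0 < b\<close> by simp
  ultimately have "g b \<in> K" by blast
  then show False using K(2) \<open>g b \<notin> U\<close> by blast
qed

section \<open>Derivatives of smooth maps\<close>

lemma smooth_onD:
  assumes "smooth_on f S" "x \<in> S"
  shows "\<exists>W g. open W \<and> x \<in> W \<and> (\<forall>k. Ck_on k g W) \<and> (\<forall>y\<in>S \<inter> W. g y = f y)"
  using assms unfolding smooth_on_def by (rule bspec)

lemma smooth_on_imp_continuous_on:
  assumes "smooth_on f S"
  shows "continuous_on S f"
  unfolding continuous_on_def
proof
  fix x assume x: "x \<in> S"
  obtain W g where W: "open W" "x \<in> W" "\<forall>k. Ck_on k g W" and eq: "\<forall>y\<in>S \<inter> W. g y = f y"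
    using smooth_onD[OF assms x] by blast
  have "continuous_on W g" using W(3)[rule_format, of 0] by simp
  then have "isCont g x" using W(1,2) by (simp add: continuous_on_eq_continuous_at)
  then have "(g \<longlongrightarrow> g x) (at x within S)"
    unfolding isCont_def by (rule tendsto_within_subset) simp
  moreover have "\<forall>\<^sub>F y in at x within S. g y = f y"
    unfolding eventually_at_topological using W(1,2) eq by blast
  ultimately show "(f \<longlongrightarrow> f x) (at x within S)"
    using eq x W(2) tendsto_cong[of g f "at x within S" "g x"] by simp
qed

lemma Ck_on_imp_has_derivative:
  assumes "Ck_on (Suc k) g W" "x \<in> W"
  shows "(g has_derivative frechet_derivative g (at x)) (at x)"
  using assms by (simp add: frechet_derivative_works[symmetric])

lemma smooth_on_derivative:
  assumes V: "open V" and f: "smooth_on f V"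
  shows smooth_on_has_derivative: "\<And>x. x \<in> V \<Longrightarrow> (f has_derivative frechet_derivative f (at x)) (at x)"
    and smooth_on_frechet_derivative: "smooth_on (\<lambda>x. frechet_derivative f (at x) v) V"
proof -
  have *: "(f has_derivative frechet_derivative g (at y)) (at y)"
    if "open W" "\<forall>k. Ck_on k g W" "\<forall>y\<in>V \<inter> W. g y = f y" "y \<in> V \<inter> W" for W g y
  proof (rule has_derivative_transform_within_open[of g _ _ _ "V \<inter> W"])
    have "Ck_on (Suc 0) g W" using that(2) by blast
    then show "(g has_derivative frechet_derivative g (at y)) (at y)"
      by (rule Ck_on_imp_has_derivative) (use that(4) in blast)
  qed (use that V in auto)
  show 1: "(f has_derivative frechet_derivative f (at x)) (at x)" if x: "x \<in> V" for x
  proof -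
    obtain W g where W: "open W" "x \<in> W" "\<forall>k. Ck_on k g W" "\<forall>y\<in>V \<inter> W. g y = f y"
      using smooth_onD[OF f x] by blast
    have "(f has_derivative frechet_derivative g (at x)) (at x)"
      by (rule *[OF W(1,3,4)]) (use x W in auto)
    then show ?thesis
      using frechet_derivative_at by metis
  qed
  show "smooth_on (\<lambda>x. frechet_derivative f (at x) v) V"
    unfolding smooth_on_def
  proof
    fix x assume "x \<in> V"
    then obtain W g where W: "open W" "x \<in> W" "\<forall>k. Ck_on k g W" "\<forall>y\<in>V \<inter> W. g y = f y"
      using smooth_onD[OF f] by blast
    have "Ck_on k (\<lambda>y. frechet_derivative g (at y) v) W" for k
      using W(3)[rule_format, of "Suc k"] by simp
    moreover have "frechet_derivative g (at y) v = frechet_derivative f (at y) v" if "y \<in> V \<inter> W" for y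
      using frechet_derivative_at[OF *[OF W(1,3,4) that]] by simp
    ultimately show "\<exists>W g. open W \<and> x \<in> W \<and> (\<forall>k. Ck_on k g W) \<and>
        (\<forall>y\<in>V \<inter> W. g y = frechet_derivative f (at y) v)"
      using W(1,2) by (intro exI[of _ W] exI[of _ "\<lambda>y. frechet_derivative g (at y) v"]) simp
  qed
qed

text \<open>Smoothness on \<open>T \<times> V\<close> refers to local extensions across the boundary of \<open>T\<close>. Derivatives in the
  direction of the open factor \<open>V\<close> do not depend on the extension.\<close>

lemma smooth_on_partial_derivative:
  fixes F :: "'a::euclidean_space \<times> 'b::euclidean_space \<Rightarrow> 'c::euclidean_space"
  assumes V: "open V" and F: "smooth_on F (T \<times> V)"
  shows smooth_on_has_partial_derivative: "\<And>t x. t \<in> T \<Longrightarrow> x \<in> V \<Longrightarrow>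
      ((\<lambda>x. F (t, x)) has_derivative frechet_derivative (\<lambda>x. F (t, x)) (at x)) (at x)"
    and smooth_on_partial_frechet_derivative:
      "smooth_on (\<lambda>(t, x). frechet_derivative (\<lambda>x. F (t, x)) (at x) v) (T \<times> V)"
proof -
  have *: "((\<lambda>x. F (t, x)) has_derivative (\<lambda>u. frechet_derivative g (at (t, y)) (0, u))) (at y)"
    if W: "open W" "\<forall>k. Ck_on k g W" "\<forall>z\<in>(T \<times> V) \<inter> W. g z = F z" "(t, y) \<in> (T \<times> V) \<inter> W" for W g t y
  proof (rule has_derivative_transform_within_open[of "\<lambda>x. g (t, x)" _ _ _ "V \<inter> (\<lambda>x. (t, x)) -` W"])
    have "Ck_on (Suc 0) g W" using W(2) by blast
    then have g: "(g has_derivative frechet_derivative g (at (t, y))) (at (t, y))"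
      by (rule Ck_on_imp_has_derivative) (use W(4) in blast)
    have "((\<lambda>x. (t, x)) has_derivative (\<lambda>u. (0, u))) (at y)"
      by (intro derivative_intros)
    from has_derivative_compose[OF this g]
    show "((\<lambda>x. g (t, x)) has_derivative (\<lambda>u. frechet_derivative g (at (t, y)) (0, u))) (at y)" .
    show "open (V \<inter> (\<lambda>x. (t, x)) -` W)"
      by (intro open_Int V open_vimage W continuous_intros)
  qed (use W in auto)
  show 1: "((\<lambda>x. F (t, x)) has_derivative frechet_derivative (\<lambda>x. F (t, x)) (at x)) (at x)"
    if tx: "t \<in> T" "x \<in> V" for t x
  proof -
    have "(t, x) \<in> T \<times> V" using tx by simp
    from smooth_onD[OF F this]
    obtain W g where W: "open W" "(t, x) \<in> W" "\<forall>k. Ck_on k g W" "\<forall>z\<in>(T \<times> V) \<inter> W. g z = F z"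
      by blast
    have "((\<lambda>x. F (t, x)) has_derivative (\<lambda>u. frechet_derivative g (at (t, x)) (0, u))) (at x)"
      by (rule *[OF W(1,3,4)]) (use tx W in auto)
    then show ?thesis
      using frechet_derivative_at by metis
  qed
  show "smooth_on (\<lambda>(t, x). frechet_derivative (\<lambda>x. F (t, x)) (at x) v) (T \<times> V)"
    unfolding smooth_on_def
  proof
    fix z assume "z \<in> T \<times> V"
    from smooth_onD[OF F this]
    obtain W g where W: "open W" "z \<in> W" "\<forall>k. Ck_on k g W" "\<forall>z\<in>(T \<times> V) \<inter> W. g z = F z"
      by blast
    have "Ck_on k (\<lambda>y. frechet_derivative g (at y) (0, v)) W" for k
      using W(3)[rule_format, of "Suc k"] by simp
    moreover have "frechet_derivative g (at y) (0, v) =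
        (case y of (t, x) \<Rightarrow> frechet_derivative (\<lambda>x. F (t, x)) (at x) v)" if y: "y \<in> (T \<times> V) \<inter> W" for y
    proof -
      obtain t x where tx: "y = (t, x)" by (rule prod.exhaust)
      have "((\<lambda>x. F (t, x)) has_derivative (\<lambda>u. frechet_derivative g (at (t, x)) (0, u))) (at x)"
        by (rule *[OF W(1,3,4)]) (use y tx in simp)
      from frechet_derivative_at[OF this] show ?thesis by (simp add: tx fun_eq_iff)
    qed
    ultimately show "\<exists>W g. open W \<and> z \<in> W \<and> (\<forall>k. Ck_on k g W) \<and>
        (\<forall>y\<in>(T \<times> V) \<inter> W. g y = (case y of (t, x) \<Rightarrow> frechet_derivative (\<lambda>x. F (t, x)) (at x) v))"
      using W(1,2) by (intro exI[of _ W] exI[of _ "\<lambda>y. frechet_derivative g (at y) (0, v)"]) simp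
  qed
qed

section \<open>Bilinear forms\<close>

lemma bilinear_expand:
  fixes f :: "'e::euclidean_space \<Rightarrow> 'e \<Rightarrow> real"
  assumes "bilinear f"
  shows "f u v = (\<Sum>i\<in>Basis. \<Sum>j\<in>Basis. (u \<bullet> i) * (v \<bullet> j) * f i j)"
proof -
  have l: "linear (\<lambda>u. f u v)" for v using assms by (simp add: bilinear_def)
  have r: "linear (f u)" for u using assms by (simp add: bilinear_def)
  have "f u v = (\<Sum>i\<in>Basis. (u \<bullet> i) * f i v)"
    using linear_sum[OF l[of v], of "\<lambda>i. (u \<bullet> i) *\<^sub>R i" Basis] linear_scale[OF l[of v]]
    by (simp add: euclidean_representation)
  also have "\<dots> = (\<Sum>i\<in>Basis. (u \<bullet> i) * (\<Sum>j\<in>Basis. (v \<bullet> j) * f i j))"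
  proof (intro sum.cong refl arg_cong2[of _ _ _ _ "(*)"])
    fix i show "f i v = (\<Sum>j\<in>Basis. (v \<bullet> j) * f i j)"
      using linear_sum[OF r[of i], of "\<lambda>j. (v \<bullet> j) *\<^sub>R j" Basis] linear_scale[OF r[of i]]
      by (simp add: euclidean_representation)
  qed
  finally show ?thesis by (simp add: sum_distrib_left mult.assoc)
qed

lemma bilinear_family_lipschitz:
  fixes \<Omega> :: "'e::euclidean_space \<Rightarrow> 'e \<Rightarrow> 'e \<Rightarrow> real"
  assumes K: "compact K" "convex K"
    and bil: "\<And>x. x \<in> K \<Longrightarrow> bilinear (\<Omega> x)"
    and der: "\<And>x u v. x \<in> K \<Longrightarrow> ((\<lambda>y. \<Omega> y u v) has_derivative (\<lambda>w. D\<Omega> x w u v)) (at x within K)"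
    and cont: "\<And>w u v. continuous_on K (\<lambda>x. D\<Omega> x w u v)"
  obtains \<kappa> where "0 \<le> \<kappa>" "\<And>x y u v. x \<in> K \<Longrightarrow> y \<in> K \<Longrightarrow>
      \<bar>\<Omega> x u v - \<Omega> y u v\<bar> \<le> \<kappa> * norm (x - y) * norm u * norm v"
proof -
  have "\<exists>B\<ge>0. \<forall>x\<in>K. \<forall>y\<in>K. \<bar>\<Omega> x i j - \<Omega> y i j\<bar> \<le> B * norm (x - y)" for i j
  proof -
    have c: "continuous_on ({0::real} \<times> K) (\<lambda>(t, x). D\<Omega> x w i j)" for w
      unfolding case_prod_beta
      by (rule continuous_on_compose2[OF cont]) (auto intro!: continuous_intros)
    obtain B where "B \<ge> 0" "\<And>t x y. t \<in> {0::real} \<Longrightarrow> x \<in> K \<Longrightarrow> y \<in> K \<Longrightarrow>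
        norm (\<Omega> x i j - \<Omega> y i j) \<le> B * norm (x - y)"
      using lipschitz_on_compact[of "{0::real}" K "\<lambda>_ x. \<Omega> x i j" "\<lambda>_ x w. D\<Omega> x w i j",
          OF compact_sing K der c] by blast
    then show ?thesis by (intro exI[of _ B]) auto
  qed
  then obtain B where B: "\<And>i j. 0 \<le> B i j"
    "\<And>i j x y. x \<in> K \<Longrightarrow> y \<in> K \<Longrightarrow> \<bar>\<Omega> x i j - \<Omega> y i j\<bar> \<le> B i j * norm (x - y)"
    by metis
  show ?thesis
  proof (rule that)
    show "0 \<le> (\<Sum>i\<in>(Basis::'e set). \<Sum>j\<in>(Basis::'e set). B i j)"
      by (intro sum_nonneg B)
    fix x y u v :: 'e assume x: "x \<in> K" and y: "y \<in> K"
    let ?c = "norm (x - y) * norm u * norm v"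
    have "\<Omega> x u v - \<Omega> y u v = (\<Sum>i\<in>Basis. \<Sum>j\<in>Basis. (u \<bullet> i) * (v \<bullet> j) * (\<Omega> x i j - \<Omega> y i j))"
      unfolding bilinear_expand[OF bil[OF x], of u v] bilinear_expand[OF bil[OF y], of u v]
      by (simp add: sum_subtractf right_diff_distrib)
    also have "\<bar>\<dots>\<bar> \<le> (\<Sum>i\<in>(Basis::'e set). \<Sum>j\<in>(Basis::'e set). B i j * ?c)"
    proof (intro order_trans[OF sum_abs] sum_mono)
      fix i j :: 'e assume ij: "i \<in> Basis" "j \<in> Basis"
      have "\<bar>u \<bullet> i\<bar> * \<bar>v \<bullet> j\<bar> \<le> norm u * norm v"
        by (intro mult_mono Basis_le_norm ij) auto
      then have "\<bar>u \<bullet> i\<bar> * \<bar>v \<bullet> j\<bar> * \<bar>\<Omega> x i j - \<Omega> y i j\<bar> \<le> norm u * norm v * (B i j * norm (x - y))"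
        by (rule mult_mono[OF _ B(2)[OF x y]]) auto
      then show "\<bar>(u \<bullet> i) * (v \<bullet> j) * (\<Omega> x i j - \<Omega> y i j)\<bar> \<le> B i j * ?c"
        by (simp add: abs_mult ac_simps)
    qed
    also have "\<dots> = (\<Sum>i\<in>(Basis::'e set). \<Sum>j\<in>(Basis::'e set). B i j) * ?c"
      by (simp only: sum_distrib_right)
    finally show "\<bar>\<Omega> x u v - \<Omega> y u v\<bar> \<le>
        (\<Sum>i\<in>(Basis::'e set). \<Sum>j\<in>(Basis::'e set). B i j) * norm (x - y) * norm u * norm v"
      by (simp only: mult.assoc)
  qed
qed

text \<open>The conclusion says that the linear map induced by \<open>\<Omega> x\<close> has an inverse of norm at most \<open>C\<close>.
  In this form a vector field given by \<open>\<Omega> x (X x) v = G x \<bullet> v\<close> can be estimated through its right-hand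
  side, and no inverse map has to be named.\<close>

lemma nondegenerate_imp_coercive:
  fixes \<Omega> :: "'e::euclidean_space \<Rightarrow> 'e \<Rightarrow> 'e \<Rightarrow> real"
  assumes "0 < R"
    and bil: "\<And>x. x \<in> cball p R \<Longrightarrow> bilinear (\<Omega> x)"
    and cont: "\<And>u v. continuous_on (cball p R) (\<lambda>x. \<Omega> x u v)"
    and nondeg: "\<And>u. (\<And>v. \<Omega> p u v = 0) \<Longrightarrow> u = 0"
  obtains r C where "0 < r" "r \<le> R" "0 \<le> C"
    "\<And>x u m. x \<in> cball p r \<Longrightarrow> (\<And>v. \<Omega> x u v \<le> m * norm v) \<Longrightarrow> norm u \<le> C * m"
proof -
  have p: "p \<in> cball p R" using \<open>0 < R\<close> by simp
  define J where "J x u = (\<Sum>j\<in>Basis. \<Omega> x u j *\<^sub>R j)" for x u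
  have J: "J x u \<bullet> v = \<Omega> x u v" if "x \<in> cball p R" for x u v
  proof -
    have r: "linear (\<Omega> x u)" using bil[OF that] by (simp add: bilinear_def)
    show ?thesis
      using linear_sum[OF r, of "\<lambda>j. (v \<bullet> j) *\<^sub>R j" Basis] linear_scale[OF r]
      by (simp add: J_def euclidean_representation inner_sum_left inner_sum_right inner_commute[of _ v] mult.commute)
  qed
  have lin: "linear (J x)" if "x \<in> cball p R" for x
  proof (rule linearI)
    have l: "linear (\<lambda>u. \<Omega> x u v)" for v using bil[OF that] by (simp add: bilinear_def)
    show "J x (u + v) = J x u + J x v" for u v
      unfolding J_def by (simp add: linear_add[OF l] scaleR_add_left sum.distrib)
    show "J x (a *\<^sub>R u) = a *\<^sub>R J x u" for a u
      unfolding J_def by (simp add: linear_scale[OF l] scaleR_sum_right)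
  qed
  have "inj (J p)"
  proof (rule linear_injective_0[OF lin[OF p], THEN iffD2], intro allI impI)
    fix u assume "J p u = 0"
    then have "\<Omega> p u v = 0" for v using J[OF p, of u v] by simp
    then show "u = 0" by (rule nondeg)
  qed
  then obtain B where "B > 0" and B: "\<And>u. B * norm u \<le> norm (J p u)"
    using linear_inj_bounded_below_pos[OF lin[OF p]] by blast
  define N where "N x = (\<Sum>i\<in>(Basis::'e set). \<Sum>j\<in>(Basis::'e set). \<bar>\<Omega> x i j - \<Omega> p i j\<bar>)" for x
  have N_cont: "continuous_on (cball p R) N"
    unfolding N_def by (intro continuous_intros cont)
  obtain d where "d > 0" and d: "\<And>x. x \<in> cball p R \<Longrightarrow> dist x p < d \<Longrightarrow> dist (N x) (N p) < B / 2"
    using N_cont[unfolded continuous_on_iff, rule_format, OF p, of "B / 2"] \<open>B > 0\<close> by auto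
  define r where "r = min R (d / 2)"
  have r: "0 < r" "r \<le> R" using \<open>0 < R\<close> \<open>d > 0\<close> by (auto simp: r_def)
  show ?thesis
  proof (rule that[OF r])
    show "0 \<le> 2 / B" using \<open>B > 0\<close> by simp
    fix x u :: 'e and m assume x: "x \<in> cball p r" and le: "\<And>v. \<Omega> x u v \<le> m * norm v"
    have x': "x \<in> cball p R" using x r by auto
    have "dist x p < d" using x \<open>d > 0\<close> by (simp add: r_def dist_commute)
    from d[OF x' this] have Nx: "N x \<le> B / 2"
      by (simp add: N_def dist_norm)
    have "norm (J x u - J p u) \<le> (\<Sum>i\<in>Basis. norm (J x i - J p i)) * norm u"
      by (rule linear_norm_le_sum_Basis) (intro linear_compose_sub lin x' p)
    also have "\<dots> \<le> N x * norm u"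
    proof (rule mult_right_mono)
      show "(\<Sum>i\<in>(Basis::'e set). norm (J x i - J p i)) \<le> N x"
        unfolding N_def
      proof (rule sum_mono)
        fix i :: 'e
        have "norm (J x i - J p i) \<le> (\<Sum>j\<in>Basis. \<bar>(J x i - J p i) \<bullet> j\<bar>)" by (rule norm_le_l1)
        then show "norm (J x i - J p i) \<le> (\<Sum>j\<in>Basis. \<bar>\<Omega> x i j - \<Omega> p i j\<bar>)"
          by (simp only: inner_diff_left J[OF x'] J[OF p])
      qed
    qed simp
    also have "\<dots> \<le> B / 2 * norm u" using Nx by (rule mult_right_mono) simp
    finally have "B / 2 * norm u \<le> norm (J x u)"
      using B[of u] norm_triangle_ineq2[of "J p u" "J x u"] by (simp add: norm_minus_commute)
    moreover have "norm (J x u) \<le> m"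
    proof (cases "J x u = 0")
      case True
      obtain i :: 'e where "i \<in> Basis" using nonempty_Basis by blast
      then have "0 \<le> m" using le[of i] J[OF x', of u i] True by simp
      then show ?thesis using True by simp
    next
      case False
      have "norm (J x u) * norm (J x u) \<le> m * norm (J x u)"
        using le[of "J x u"] J[OF x', of u "J x u"] by (simp add: power2_norm_eq_inner[symmetric] power2_eq_square)
      then show ?thesis using False by simp
    qed
    ultimately show "norm u \<le> 2 / B * m" using \<open>B > 0\<close> by (simp add: field_simps)
  qed
qed

section \<open>The Poincare lemma for 2-forms\<close>

text \<open>The usual primitive \<open>\<lambda>\<^sub>x(v) = \<integral> s \<Omega>\<^sub>y(x - p, v) ds\<close>, with \<open>y = p + s (x - p)\<close> and \<open>s\<close> from 0 to 1.
  Its derivative in direction \<open>u\<close> has the integrand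
  \<open>s (s D\<Omega>\<^sub>y(u)(x - p, v) + \<Omega>\<^sub>y(u, v))\<close>, and closedness turns the antisymmetric part of
  it into the derivative of \<open>s\<^sup>2 \<Omega>\<^sub>y(u, v)\<close>. The 1-form is represented by the vector field \<open>lam\<close>
  through the inner product.\<close>

lemma poincare_two_form:
  fixes \<Omega> :: "'e::euclidean_space \<Rightarrow> 'e \<Rightarrow> 'e \<Rightarrow> real"
  assumes K: "compact K" "convex K" "p \<in> K"
    and bil: "\<And>x. x \<in> K \<Longrightarrow> bilinear (\<Omega> x)"
    and der: "\<And>x u v. x \<in> K \<Longrightarrow> ((\<lambda>y. \<Omega> y u v) has_derivative (\<lambda>w. D\<Omega> x w u v)) (at x within K)"
    and skew: "\<And>x u v. x \<in> K \<Longrightarrow> \<Omega> x u v = - \<Omega> x v u"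
    and Dbil: "\<And>x w. x \<in> K \<Longrightarrow> bilinear (D\<Omega> x w)"
    and Dskew: "\<And>x w u v. x \<in> K \<Longrightarrow> D\<Omega> x w u v = - D\<Omega> x w v u"
    and cont: "\<And>w u v. continuous_on K (\<lambda>x. D\<Omega> x w u v)"
    and closed: "\<And>x u v w. x \<in> K \<Longrightarrow> D\<Omega> x u v w + D\<Omega> x v w u + D\<Omega> x w u v = 0"
  shows "\<exists>lam Dlam. (\<forall>x\<in>K. (lam has_derivative Dlam x) (at x within K)) \<and>
    (\<forall>u. continuous_on K (\<lambda>x. Dlam x u)) \<and>
    (\<forall>x\<in>K. \<forall>u v. Dlam x u \<bullet> v - Dlam x v \<bullet> u = \<Omega> x u v)"
proof -
  have K': "p + s *\<^sub>R (x - p) \<in> K" if "x \<in> K" "s \<in> {0..1}" for x s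
    using convexD_alt[OF K(2,3) that(1), of s] that(2) by (simp add: algebra_simps)
  have \<Omega>_sum: "\<Omega> x z v = (\<Sum>i\<in>Basis. (z \<bullet> i) * \<Omega> x i v)" if "x \<in> K" for x z v
  proof -
    have "linear (\<lambda>z. \<Omega> x z v)" using bil[OF that] by (auto simp: bilinear_def)
    from linear_sum[OF this, of "\<lambda>i. (z \<bullet> i) *\<^sub>R i" Basis] linear_scale[OF this]
    show ?thesis by (simp add: euclidean_representation)
  qed
  have D\<Omega>_sum: "D\<Omega> x w z v = (\<Sum>i\<in>Basis. (z \<bullet> i) * D\<Omega> x w i v)" if "x \<in> K" for x w z v
  proof -
    have "linear (\<lambda>z. D\<Omega> x w z v)" using Dbil[OF that] by (auto simp: bilinear_def)
    from linear_sum[OF this, of "\<lambda>i. (z \<bullet> i) *\<^sub>R i" Basis] linear_scale[OF this]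
    show ?thesis by (simp add: euclidean_representation)
  qed
  have \<Omega>_cont: "continuous_on K (\<lambda>x. \<Omega> x u v)" for u v
    using der has_derivative_continuous unfolding continuous_on_eq_continuous_within by blast
  have ray: "continuous_on (K \<times> {0..1}) (\<lambda>(x, s). p + s *\<^sub>R (x - p))"
    unfolding case_prod_beta by (intro continuous_intros)
  have ray_in: "(\<lambda>(x, s). p + s *\<^sub>R (x - p)) ` (K \<times> {0..1}) \<subseteq> K"
    using K' by auto
  have \<Omega>_ray: "continuous_on (K \<times> {0..1}) (\<lambda>(x, s). \<Omega> (p + s *\<^sub>R (x - p)) u v)" for u v
    using continuous_on_compose2[OF \<Omega>_cont ray ray_in] by (simp add: case_prod_beta)
  have D\<Omega>_ray: "continuous_on (K \<times> {0..1}) (\<lambda>(x, s). D\<Omega> (p + s *\<^sub>R (x - p)) w u v)" for w u v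
    using continuous_on_compose2[OF cont ray ray_in] by (simp add: case_prod_beta)
  define d where "d x s u v =
      s * (s * D\<Omega> (p + s *\<^sub>R (x - p)) u (x - p) v + \<Omega> (p + s *\<^sub>R (x - p)) u v)" for x s u v
  have d_eq: "d x s u v = s * (s * (\<Sum>i\<in>Basis. ((x - p) \<bullet> i) * D\<Omega> (p + s *\<^sub>R (x - p)) u i v)
      + \<Omega> (p + s *\<^sub>R (x - p)) u v)" if "x \<in> K" "s \<in> {0..1}" for x s u v
    unfolding d_def by (subst D\<Omega>_sum[OF K'[OF that]]) (rule refl)
  have d_cont: "continuous_on (K \<times> {0..1}) (\<lambda>(x, s). d x s u v)" for u v
  proof -
    have "continuous_on (K \<times> {0..1}) (\<lambda>z. snd z * (snd z * (\<Sum>i\<in>Basis. ((fst z - p) \<bullet> i) *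
        D\<Omega> (p + snd z *\<^sub>R (fst z - p)) u i v) + \<Omega> (p + snd z *\<^sub>R (fst z - p)) u v))"
      using \<Omega>_ray D\<Omega>_ray unfolding case_prod_beta by (intro continuous_intros)
    then show ?thesis
      by (rule continuous_on_eq) (auto simp: d_eq)
  qed
  have d_lin: "linear (\<lambda>u. d x s u v)" if "x \<in> K" "s \<in> {0..1}" for x s v
  proof -
    note y = K'[OF that]
    have "linear (\<lambda>u. D\<Omega> (p + s *\<^sub>R (x - p)) u (x - p) v)"
      using der[OF y] by (rule has_derivative_linear)
    moreover have "linear (\<lambda>u. \<Omega> (p + s *\<^sub>R (x - p)) u v)"
      using bil[OF y] by (simp add: bilinear_def)
    ultimately show ?thesis
      unfolding d_def by (intro linear_compose_scale_right[where 'b = real, simplified] linear_compose_add)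
  qed
  have d_int: "(\<lambda>s. d x s u v) integrable_on {0..1}" if "x \<in> K" for x u v
    by (intro integrable_continuous_interval continuous_on_slice[OF d_cont that])
  \<comment> \<open>The derivative \<open>u \<mapsto> d x s u j\<close> as a vector: \<^const>\<open>blinfun_inner_right\<close> then turns it into the
    bounded linear function that differentiation under the integral sign asks for.\<close>
  define g where "g j x s = (\<Sum>i\<in>Basis. d x s i j *\<^sub>R i)" for j x s
  have g_inner: "g j x s \<bullet> u = d x s u j" if "x \<in> K" "s \<in> {0..1}" for j x s u
  proof -
    have "d x s u j = (\<Sum>i\<in>Basis. (u \<bullet> i) * d x s i j)"
      using linear_sum[OF d_lin[OF that], of "\<lambda>i. (u \<bullet> i) *\<^sub>R i" Basis j] linear_scale[OF d_lin[OF that]]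
      by (simp add: euclidean_representation)
    then show ?thesis
      by (simp add: g_def inner_sum_left inner_sum_right inner_commute[of _ u] mult.commute)
  qed
  have g_cont: "continuous_on (K \<times> {0..1}) (\<lambda>(x, s). g j x s)" for j
    using d_cont unfolding g_def case_prod_beta by (intro continuous_intros)
  have g_int: "g j x integrable_on {0..1}" if "x \<in> K" for j x
    by (intro integrable_continuous_interval continuous_on_slice[OF g_cont that])
  define a where "a j x = integral {0..1} (\<lambda>s. s * \<Omega> (p + s *\<^sub>R (x - p)) (x - p) j)" for j x
  have a_der: "(a j has_derivative (\<lambda>u. integral {0..1} (g j x) \<bullet> u)) (at x within K)" if x: "x \<in> K" for j x
  proof -
    let ?f = "\<lambda>x s. s * \<Omega> (p + s *\<^sub>R (x - p)) (x - p) j"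
    have "((\<lambda>x. integral (cbox 0 1) (?f x)) has_derivative
        blinfun_apply (integral (cbox 0 1) (\<lambda>s. blinfun_inner_right (g j x s)))) (at x within K)"
    proof (rule leibniz_rule[OF _ _ _ x K(2)])
      fix y s assume y: "y \<in> K" and s: "s \<in> cbox 0 (1::real)"
      then have s': "s \<in> {0..1}" by simp
      have "((\<lambda>x. \<Omega> (p + s *\<^sub>R (x - p)) i j) has_derivative
          (\<lambda>u. D\<Omega> (p + s *\<^sub>R (y - p)) (s *\<^sub>R u) i j)) (at y within K)" for i
      proof (rule has_derivative_in_compose[where g = "\<lambda>x. \<Omega> x i j" and f = "\<lambda>x. p + s *\<^sub>R (x - p)"])
        show "((\<lambda>x. p + s *\<^sub>R (x - p)) has_derivative (\<lambda>u. s *\<^sub>R u)) (at y within K)"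
          by (auto intro!: derivative_eq_intros)
        show "((\<lambda>x. \<Omega> x i j) has_derivative (\<lambda>w. D\<Omega> (p + s *\<^sub>R (y - p)) w i j))
            (at (p + s *\<^sub>R (y - p)) within (\<lambda>x. p + s *\<^sub>R (x - p)) ` K)"
          by (rule has_derivative_subset[OF der]) (use K' y s' in auto)
      qed
      moreover have "D\<Omega> (p + s *\<^sub>R (y - p)) (s *\<^sub>R u) i j = s * D\<Omega> (p + s *\<^sub>R (y - p)) u i j" for u i
        using linear_scale[OF has_derivative_linear[OF der[OF K'[OF y s']]]] by simp
      ultimately have 1: "((\<lambda>x. \<Omega> (p + s *\<^sub>R (x - p)) i j) has_derivative
          (\<lambda>u. s * D\<Omega> (p + s *\<^sub>R (y - p)) u i j)) (at y within K)" for i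
        by simp
      have "((\<lambda>x. s * (\<Sum>i\<in>Basis. ((x - p) \<bullet> i) * \<Omega> (p + s *\<^sub>R (x - p)) i j)) has_derivative
          (\<lambda>u. s * (\<Sum>i\<in>Basis. ((y - p) \<bullet> i) * (s * D\<Omega> (p + s *\<^sub>R (y - p)) u i j) +
            (u \<bullet> i) * \<Omega> (p + s *\<^sub>R (y - p)) i j))) (at y within K)"
        by (intro has_derivative_mult_right has_derivative_sum) (auto intro!: derivative_eq_intros 1)
      also have "(\<lambda>u. s * (\<Sum>i\<in>Basis. ((y - p) \<bullet> i) * (s * D\<Omega> (p + s *\<^sub>R (y - p)) u i j) +
            (u \<bullet> i) * \<Omega> (p + s *\<^sub>R (y - p)) i j)) = (\<lambda>u. d y s u j)"
      proof
        fix u show "s * (\<Sum>i\<in>Basis. ((y - p) \<bullet> i) * (s * D\<Omega> (p + s *\<^sub>R (y - p)) u i j) +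
            (u \<bullet> i) * \<Omega> (p + s *\<^sub>R (y - p)) i j) = d y s u j"
          by (simp add: d_eq[OF y s'] \<Omega>_sum[OF K'[OF y s'], of u j] sum.distrib sum_distrib_left mult.left_commute)
      qed
      also have "\<dots> = blinfun_apply (blinfun_inner_right (g j y s))"
        by (auto simp: g_inner[OF y s'])
      finally have sum: "((\<lambda>x. s * (\<Sum>i\<in>Basis. ((x - p) \<bullet> i) * \<Omega> (p + s *\<^sub>R (x - p)) i j))
          has_derivative blinfun_apply (blinfun_inner_right (g j y s))) (at y within K)" .
      have eq: "?f x s = s * (\<Sum>i\<in>Basis. ((x - p) \<bullet> i) * \<Omega> (p + s *\<^sub>R (x - p)) i j)" if "x \<in> K" for x
        by (simp add: \<Omega>_sum[OF K'[OF that s'], of "x - p" j])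
      show "((\<lambda>x. ?f x s) has_derivative blinfun_apply (blinfun_inner_right (g j y s))) (at y within K)"
        by (rule has_derivative_transform[OF y eq sum])
    next
      fix y assume y: "y \<in> K"
      have "continuous_on {0..1} (\<lambda>s. s * (\<Sum>i\<in>Basis. ((y - p) \<bullet> i) * \<Omega> (p + s *\<^sub>R (y - p)) i j))"
        by (intro continuous_intros continuous_on_slice[OF \<Omega>_ray y])
      then have "continuous_on {0..1} (?f y)"
        by (rule continuous_on_eq) (simp add: \<Omega>_sum[OF K'[OF y], of _ "y - p" j])
      then show "?f y integrable_on cbox 0 1"
        by (simp add: integrable_continuous_interval)
    next
      show "continuous_on (K \<times> cbox 0 1) (\<lambda>(x, s). blinfun_inner_right (g j x s))"
        using bounded_linear.continuous_on[OF bounded_linear_blinfun_inner_right g_cont[of j]]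
        by (simp add: case_prod_beta)
    qed
    moreover have "integral (cbox 0 1) (\<lambda>s. blinfun_inner_right (g j x s)) = blinfun_inner_right (integral {0..1} (g j x))"
      using integral_linear[OF g_int[OF x] bounded_linear_blinfun_inner_right] by (simp add: o_def)
    ultimately show ?thesis by (simp add: a_def[abs_def])
  qed
  define lam where "lam x = (\<Sum>j\<in>Basis. a j x *\<^sub>R j)" for x
  define Dlam where "Dlam x u = (\<Sum>j\<in>Basis. (integral {0..1} (g j x) \<bullet> u) *\<^sub>R j)" for x u
  have Dlam_inner: "Dlam x u \<bullet> v = integral {0..1} (\<lambda>s. d x s u v)" if x: "x \<in> K" for x u v
  proof -
    have dv: "d x s u v = (\<Sum>j\<in>Basis. (v \<bullet> j) * (g j x s \<bullet> u))" if s: "s \<in> {0..1}" for s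
    proof -
      note y = K'[OF x s]
      have "linear (\<lambda>v. D\<Omega> (p + s *\<^sub>R (x - p)) u (x - p) v)" "linear (\<lambda>v. \<Omega> (p + s *\<^sub>R (x - p)) u v)"
        using Dbil[OF y] bil[OF y] by (simp_all add: bilinear_def)
      then have l: "linear (d x s u)"
        unfolding d_def[abs_def] by (intro linear_compose_scale_right[where 'b = real, simplified] linear_compose_add)
      show ?thesis
        using linear_sum[OF l, of "\<lambda>i. (v \<bullet> i) *\<^sub>R i" Basis] linear_scale[OF l]
        by (simp add: euclidean_representation g_inner[OF x s])
    qed
    have "((\<lambda>s. \<Sum>j\<in>Basis. (v \<bullet> j) * (g j x s \<bullet> u)) has_integral
        (\<Sum>j\<in>Basis. (v \<bullet> j) * (integral {0..1} (g j x) \<bullet> u))) {0..1}"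
      by (intro has_integral_sum finite_Basis has_integral_mult_right
          has_integral_linear[OF integrable_integral[OF g_int[OF x]] bounded_linear_inner_left, unfolded o_def])
    then have "integral {0..1} (\<lambda>s. \<Sum>j\<in>Basis. (v \<bullet> j) * (g j x s \<bullet> u)) =
        (\<Sum>j\<in>Basis. (v \<bullet> j) * (integral {0..1} (g j x) \<bullet> u))"
      by (rule integral_unique)
    moreover have "integral {0..1} (\<lambda>s. \<Sum>j\<in>Basis. (v \<bullet> j) * (g j x s \<bullet> u)) = integral {0..1} (\<lambda>s. d x s u v)"
      by (rule integral_cong) (simp add: dv)
    ultimately show ?thesis
      by (simp add: Dlam_def inner_sum_left inner_sum_right inner_commute[of _ v] mult.commute)
  qed
  show ?thesis
  proof (intro exI[of _ lam] exI[of _ Dlam] conjI ballI allI)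
    show "(lam has_derivative Dlam x) (at x within K)" if "x \<in> K" for x
      unfolding lam_def Dlam_def
      by (intro has_derivative_sum has_derivative_scaleR_left a_der that)
    show "continuous_on K (\<lambda>x. Dlam x u)" for u
      unfolding Dlam_def
      using integral_continuous_on_param[where U = K and a = "0::real" and b = 1 and f = "g j" for j] g_cont
      by (intro continuous_intros) auto
    fix x u v assume x: "x \<in> K"
    let ?y = "\<lambda>s. p + s *\<^sub>R (x - p)"
    have "((\<lambda>s. s\<^sup>2 * D\<Omega> (?y s) (x - p) u v + 2 * s * \<Omega> (?y s) u v) has_integral
        1\<^sup>2 * \<Omega> (?y 1) u v - 0\<^sup>2 * \<Omega> (?y 0) u v) {0..1}"
    proof (rule fundamental_theorem_of_calculus)
      fix s :: real assume s: "s \<in> {0..1}"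
      have y': "(?y has_vector_derivative (x - p)) (at s within {0..1})"
        by (auto intro!: derivative_eq_intros)
      have "(((\<lambda>y. \<Omega> y u v) \<circ> ?y) has_vector_derivative D\<Omega> (?y s) (x - p) u v) (at s within {0..1})"
        by (rule vector_derivative_diff_chain_within[OF y'], rule has_derivative_subset[OF der])
          (use K' x s in auto)
      then have "((\<lambda>s. \<Omega> (?y s) u v) has_real_derivative D\<Omega> (?y s) (x - p) u v) (at s within {0..1})"
        by (simp add: o_def has_real_derivative_iff_has_vector_derivative)
      then have "((\<lambda>s. s\<^sup>2 * \<Omega> (?y s) u v) has_real_derivative
          s\<^sup>2 * D\<Omega> (?y s) (x - p) u v + 2 * s * \<Omega> (?y s) u v) (at s within {0..1})"
        by (auto intro!: derivative_eq_intros)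
      then show "((\<lambda>s. s\<^sup>2 * \<Omega> (?y s) u v) has_vector_derivative
          s\<^sup>2 * D\<Omega> (?y s) (x - p) u v + 2 * s * \<Omega> (?y s) u v) (at s within {0..1})"
        by (simp add: has_real_derivative_iff_has_vector_derivative)
    qed simp
    then have "integral {0..1} (\<lambda>s. s\<^sup>2 * D\<Omega> (?y s) (x - p) u v + 2 * s * \<Omega> (?y s) u v) = \<Omega> x u v"
      by (simp add: integral_unique)
    moreover have "d x s u v - d x s v u = s\<^sup>2 * D\<Omega> (?y s) (x - p) u v + 2 * s * \<Omega> (?y s) u v"
      if s: "s \<in> {0..1}" for s
    proof -
      note y = K'[OF x s]
      have "D\<Omega> (?y s) u (x - p) v - D\<Omega> (?y s) v (x - p) u = D\<Omega> (?y s) (x - p) u v"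
        using closed[OF y, of u "x - p" v] Dskew[OF y, of "x - p" v u] Dskew[OF y, of v u "x - p"] by simp
      moreover have "\<Omega> (?y s) v u = - \<Omega> (?y s) u v"
        by (rule skew[OF y])
      ultimately show ?thesis
        by (simp add: d_def power2_eq_square algebra_simps)
    qed
    then have "integral {0..1} (\<lambda>s. d x s u v - d x s v u) =
        integral {0..1} (\<lambda>s. s\<^sup>2 * D\<Omega> (?y s) (x - p) u v + 2 * s * \<Omega> (?y s) u v)"
      by (rule integral_cong)
    ultimately show "Dlam x u \<bullet> v - Dlam x v \<bullet> u = \<Omega> x u v"
      using integral_diff[OF d_int[OF x] d_int[OF x], of u v v u] by (simp add: Dlam_inner[OF x])
  qed
qed

section \<open>Hamiltonian orbits near a degenerate maximum\<close>

text \<open>The Hamiltonian system in a ball of a chart. The gradient of \<open>h t\<close> is \<open>G t\<close>, its derivative \<open>D t\<close> is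
  the Hessian, \<open>X t\<close> is the Hamiltonian vector field and \<open>lam\<close> represents a primitive of the
  symplectic form.\<close>

locale hamiltonian_ball =
  fixes p :: "'e::euclidean_space" and r :: real
    and \<Omega> :: "'e \<Rightarrow> 'e \<Rightarrow> 'e \<Rightarrow> real"
    and lam :: "'e \<Rightarrow> 'e" and Dlam :: "'e \<Rightarrow> 'e \<Rightarrow> 'e"
    and C \<kappa> :: real
    and h :: "real \<Rightarrow> 'e \<Rightarrow> real" and G :: "real \<Rightarrow> 'e \<Rightarrow> 'e" and D :: "real \<Rightarrow> 'e \<Rightarrow> 'e \<Rightarrow> 'e"
    and X :: "real \<Rightarrow> 'e \<Rightarrow> 'e"
  assumes r_pos: "0 < r"
    and \<Omega>_bilinear: "x \<in> cball p r \<Longrightarrow> bilinear (\<Omega> x)"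
    and \<Omega>_skew: "x \<in> cball p r \<Longrightarrow> \<Omega> x u v = - \<Omega> x v u"
    and \<Omega>_coercive: "x \<in> cball p r \<Longrightarrow> (\<And>v. \<Omega> x u v \<le> m * norm v) \<Longrightarrow> norm u \<le> C * m"
    and \<Omega>_lipschitz: "x \<in> cball p r \<Longrightarrow> y \<in> cball p r \<Longrightarrow>
      \<bar>\<Omega> x u v - \<Omega> y u v\<bar> \<le> \<kappa> * norm (x - y) * norm u * norm v"
    and C_nonneg: "0 \<le> C" and \<kappa>_nonneg: "0 \<le> \<kappa>"
    and lam_deriv: "x \<in> cball p r \<Longrightarrow> (lam has_derivative Dlam x) (at x within cball p r)"
    and Dlam_cont: "continuous_on (cball p r) (\<lambda>x. Dlam x u)"
    and Dlam_skew: "x \<in> cball p r \<Longrightarrow> Dlam x u \<bullet> v - Dlam x v \<bullet> u = \<Omega> x u v"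
    and h_deriv: "t \<in> {0..1} \<Longrightarrow> x \<in> cball p r \<Longrightarrow>
      (h t has_derivative (\<lambda>u. G t x \<bullet> u)) (at x within cball p r)"
    and G_deriv: "t \<in> {0..1} \<Longrightarrow> x \<in> cball p r \<Longrightarrow> (G t has_derivative D t x) (at x within cball p r)"
    and h_cont: "continuous_on ({0..1} \<times> cball p r) (\<lambda>(t, x). h t x)"
    and G_cont: "continuous_on ({0..1} \<times> cball p r) (\<lambda>(t, x). G t x)"
    and D_cont: "continuous_on ({0..1} \<times> cball p r) (\<lambda>(t, x). D t x u)"
    and X: "t \<in> {0..1} \<Longrightarrow> x \<in> cball p r \<Longrightarrow> \<Omega> x (X t x) v = G t x \<bullet> v"
    and h_max: "t \<in> {0..1} \<Longrightarrow> x \<in> cball p r \<Longrightarrow> h t x \<le> h t p"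
begin

lemma p_in: "p \<in> cball p r"
  using r_pos by simp

lemma at_p: "at p within cball p r = at p"
  by (rule at_within_interior) (use r_pos in \<open>simp add: interior_cball\<close>)

lemma G_p: "t \<in> {0..1} \<Longrightarrow> G t p = 0"
proof -
  assume t: "t \<in> {0..1}"
  have "(\<lambda>u. G t p \<bullet> u) = (\<lambda>u. 0)"
  proof (rule differential_zero_maxmin)
    show "(h t has_derivative (\<lambda>u. G t p \<bullet> u)) (at p)"
      using h_deriv[OF t p_in] by (simp add: at_p)
    show "p \<in> ball p r" "open (ball p r)" using r_pos by auto
    show "(\<forall>y\<in>ball p r. h t y \<le> h t p) \<or> (\<forall>y\<in>ball p r. h t p \<le> h t y)"
      using h_max[OF t] by auto
  qed
  then show "G t p = 0" by (metis inner_eq_zero_iff)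
qed

text \<open>Continuity, boundedness and the Lipschitz property of \<open>X\<close> all come from this comparison. Only the term
  with \<open>X s y\<close> sees the change of base point of \<open>\<Omega>\<close>.\<close>

lemma X_diff_le:
  assumes "t \<in> {0..1}" "s \<in> {0..1}" "x \<in> cball p r" "y \<in> cball p r"
  shows "norm (X t x - X s y) \<le> C * (norm (G t x - G s y) + \<kappa> * norm (x - y) * norm (X s y))"
proof (rule \<Omega>_coercive[OF assms(3)])
  fix v
  have "\<Omega> x (X t x - X s y) v = \<Omega> x (X t x) v - \<Omega> x (X s y) v"
    using \<Omega>_bilinear[OF assms(3)] by (rule bilinear_lsub)
  also have "\<dots> = (G t x - G s y) \<bullet> v - (\<Omega> x (X s y) v - \<Omega> y (X s y) v)"
    using X assms by (simp add: inner_diff_left)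
  also have "\<dots> \<le> norm (G t x - G s y) * norm v + \<kappa> * norm (x - y) * norm (X s y) * norm v"
    using norm_cauchy_schwarz[of "G t x - G s y" v] \<Omega>_lipschitz[OF assms(3,4), of "X s y" v]
    by linarith
  finally show "\<Omega> x (X t x - X s y) v \<le> (norm (G t x - G s y) + \<kappa> * norm (x - y) * norm (X s y)) * norm v"
    by (simp add: distrib_right)
qed

lemma X_le: 
  assumes "t \<in> {0..1}" "x \<in> cball p r"
  shows "norm (X t x) \<le> C * norm (G t x)"
  by (rule \<Omega>_coercive[OF assms(2)]) (unfold X[OF assms], rule norm_cauchy_schwarz)

lemma X_p: "t \<in> {0..1} \<Longrightarrow> X t p = 0"
  using X_le[OF _ p_in, of t] G_p[of t] by simp

lemma X_bounded:
  obtains M where "M \<ge> 0" "\<And>t x. t \<in> {0..1} \<Longrightarrow> x \<in> cball p r \<Longrightarrow> norm (X t x) \<le> M"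
proof -
  obtain N where N: "N \<ge> 0" "\<And>t x. t \<in> {0..1} \<Longrightarrow> x \<in> cball p r \<Longrightarrow> norm (G t x) \<le> N"
    using bounded_on_compact_times[OF compact_Icc compact_cball G_cont] by blast
  show ?thesis
  proof (rule that)
    show "0 \<le> C * N" using N C_nonneg by simp
    show "norm (X t x) \<le> C * N" if "t \<in> {0..1}" "x \<in> cball p r" for t x
      using X_le[OF that] mult_left_mono[OF N(2)[OF that] C_nonneg] by linarith
  qed
qed

lemma X_cont: "continuous_on ({0..1} \<times> cball p r) (\<lambda>(t, x). X t x)"
  unfolding continuous_on_def
proof
  fix z :: "real \<times> 'e" assume z: "z \<in> {0..1} \<times> cball p r"
  obtain s y where [simp]: "z = (s, y)" by (cases z)
  let ?F = "at z within {0..1} \<times> cball p r"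
  have "((\<lambda>(t, x). G t x) \<longlongrightarrow> G s y) ?F"
    using G_cont z by (auto simp: continuous_on_def)
  then have "((\<lambda>w. C * (norm ((case w of (t, x) \<Rightarrow> G t x) - G s y) + \<kappa> * norm (snd w - y) * norm (X s y)))
      \<longlongrightarrow> C * (norm (G s y - G s y) + \<kappa> * norm (snd z - y) * norm (X s y))) ?F"
    by (intro tendsto_intros)
  then have "((\<lambda>w. C * (norm ((case w of (t, x) \<Rightarrow> G t x) - G s y) + \<kappa> * norm (snd w - y) * norm (X s y)))
      \<longlongrightarrow> 0) ?F"
    by simp
  then have "((\<lambda>w. (case w of (t, x) \<Rightarrow> X t x) - X s y) \<longlongrightarrow> 0) ?F"
  proof (rule Lim_null_comparison[rotated])
    show "\<forall>\<^sub>F w in ?F. norm ((case w of (t, x) \<Rightarrow> X t x) - X s y)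
        \<le> C * (norm ((case w of (t, x) \<Rightarrow> G t x) - G s y) + \<kappa> * norm (snd w - y) * norm (X s y))"
      unfolding eventually_at_filter using X_diff_le[of _ s _ y] z by (auto intro!: always_eventually)
  qed
  then show "((\<lambda>(t, x). X t x) \<longlongrightarrow> (case z of (t, x) \<Rightarrow> X t x)) ?F"
    by (simp add: LIM_zero_iff)
qed

lemma X_lipschitz:
  obtains L where "L \<ge> 0"
    "\<And>t x y. t \<in> {0..1} \<Longrightarrow> x \<in> cball p r \<Longrightarrow> y \<in> cball p r \<Longrightarrow> norm (X t x - X t y) \<le> L * norm (x - y)"
proof -
  obtain B where B: "B \<ge> 0"
    "\<And>t x y. t \<in> {0..1} \<Longrightarrow> x \<in> cball p r \<Longrightarrow> y \<in> cball p r \<Longrightarrow> norm (G t x - G t y) \<le> B * norm (x - y)"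
    using lipschitz_on_compact[OF compact_Icc compact_cball convex_cball G_deriv D_cont] by blast
  obtain M where M: "M \<ge> 0" "\<And>t x. t \<in> {0..1} \<Longrightarrow> x \<in> cball p r \<Longrightarrow> norm (X t x) \<le> M"
    using X_bounded by blast
  show ?thesis
  proof (rule that)
    show "0 \<le> C * (B + \<kappa> * M)" using B M C_nonneg \<kappa>_nonneg by simp
    fix t :: real and x y assume t: "t \<in> {0..1}" and xy: "x \<in> cball p r" "y \<in> cball p r"
    have "norm (X t x - X t y) \<le> C * (norm (G t x - G t y) + \<kappa> * norm (x - y) * norm (X t y))"
      by (rule X_diff_le) fact+
    also have "\<dots> \<le> C * (B * norm (x - y) + \<kappa> * norm (x - y) * M)"
      using B(2)[OF t xy] M(2)[OF t xy(2)] C_nonneg \<kappa>_nonneg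
      by (intro mult_left_mono add_mono) auto
    finally show "norm (X t x - X t y) \<le> C * (B + \<kappa> * M) * norm (x - y)"
      by (simp add: algebra_simps)
  qed
qed

end

text \<open>The orbit of \<open>x\<close> is \<open>\<Gamma> x\<close>. Orbits are closed and stay in the ball, and total degeneracy of \<open>p\<close> is the
  assumption \<open>\<Gamma>_degenerate\<close>.\<close>

locale hamiltonian_loops = hamiltonian_ball p r \<Omega> lam Dlam C \<kappa> h G D X
  for p :: "'e::euclidean_space" and r \<Omega> lam Dlam C \<kappa> h G D X +
  fixes L \<delta> :: real and \<Gamma> :: "'e \<Rightarrow> real \<Rightarrow> 'e"
  assumes X_lip: "t \<in> {0..1} \<Longrightarrow> x \<in> cball p r \<Longrightarrow> y \<in> cball p r \<Longrightarrow> norm (X t x - X t y) \<le> L * norm (x - y)"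
    and L_nonneg: "0 \<le> L" and \<delta>_pos: "0 < \<delta>"
    and \<Gamma>_in: "x \<in> ball p \<delta> \<Longrightarrow> t \<in> {0..1} \<Longrightarrow> \<Gamma> x t \<in> cball p r"
    and \<Gamma>_0: "x \<in> ball p \<delta> \<Longrightarrow> \<Gamma> x 0 = x"
    and \<Gamma>_1: "x \<in> ball p \<delta> \<Longrightarrow> \<Gamma> x 1 = x"
    and \<Gamma>_deriv: "x \<in> ball p \<delta> \<Longrightarrow> t \<in> {0..1} \<Longrightarrow>
      (\<Gamma> x has_vector_derivative X t (\<Gamma> x t)) (at t within {0..1})"
    and \<Gamma>_degenerate: "t \<in> {0..1} \<Longrightarrow> ((\<lambda>x. \<Gamma> x t) has_derivative (\<lambda>u. u)) (at p)"
begin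

lemma p_ball: "p \<in> ball p \<delta>"
  using \<delta>_pos by simp

lemma \<Gamma>_cont: "x \<in> ball p \<delta> \<Longrightarrow> continuous_on {0..1} (\<Gamma> x)"
  by (rule continuous_on_vector_derivative) (rule \<Gamma>_deriv)

lemma along_\<Gamma>_cont:
  assumes "x \<in> ball p \<delta>" "continuous_on ({0..1} \<times> cball p r) (\<lambda>(t, x). F t x)"
  shows "continuous_on {0..1} (\<lambda>t. F t (\<Gamma> x t))"
proof -
  have "continuous_on {0..1} (\<lambda>t. (\<lambda>(t, x). F t x) (t, \<Gamma> x t))"
    by (rule continuous_on_compose2[OF assms(2)])
      (use \<Gamma>_in assms(1) in \<open>auto intro!: continuous_intros \<Gamma>_cont\<close>)
  then show ?thesis by simp
qed

lemma \<Gamma>_lipschitz: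
  assumes x: "x \<in> ball p \<delta>" and y: "y \<in> ball p \<delta>" and t: "t \<in> {0..1}"
  shows "norm (\<Gamma> x t - \<Gamma> y t) \<le> exp L * norm (x - y)"
proof -
  have "norm (\<Gamma> x t - \<Gamma> y t) \<le> exp (L * t) * norm (\<Gamma> x 0 - \<Gamma> y 0)"
  proof (rule norm_le_exp_mult_norm[OF _ _ t])
    fix s :: real assume s: "s \<in> {0..1}"
    show "((\<lambda>s. \<Gamma> x s - \<Gamma> y s) has_vector_derivative X s (\<Gamma> x s) - X s (\<Gamma> y s)) (at s within {0..1})"
      by (intro has_vector_derivative_diff \<Gamma>_deriv x y s)
    show "norm (X s (\<Gamma> x s) - X s (\<Gamma> y s)) \<le> L * norm (\<Gamma> x s - \<Gamma> y s)"
      by (intro X_lip \<Gamma>_in x y s)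
  qed
  also have "\<dots> \<le> exp L * norm (\<Gamma> x 0 - \<Gamma> y 0)"
    using t L_nonneg by (intro mult_right_mono) (auto simp: mult_left_le)
  finally show ?thesis by (simp add: \<Gamma>_0[OF x] \<Gamma>_0[OF y])
qed

lemma \<Gamma>_p: "t \<in> {0..1} \<Longrightarrow> \<Gamma> p t = p"
proof -
  assume t: "t \<in> {0..1}"
  have "norm (\<Gamma> p t - p) \<le> exp (L * t) * norm (\<Gamma> p 0 - p)"
  proof (rule norm_le_exp_mult_norm[OF _ _ t])
    fix s :: real assume s: "s \<in> {0..1}"
    show "((\<lambda>s. \<Gamma> p s - p) has_vector_derivative X s (\<Gamma> p s)) (at s within {0..1})"
      using has_vector_derivative_diff[OF \<Gamma>_deriv[OF p_ball s] has_vector_derivative_const[of p]] by simp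
    show "norm (X s (\<Gamma> p s)) \<le> L * norm (\<Gamma> p s - p)"
      using X_lip[OF s \<Gamma>_in[OF p_ball s] p_in] X_p[OF s] by simp
  qed
  then show "\<Gamma> p t = p" by (simp add: \<Gamma>_0[OF p_ball])
qed

text \<open>The linearised flow at \<open>p\<close> is generated by the Hessian, transformed by \<open>\<Omega> p\<close>, and it is the identity
  at all times. To see this without differentiating the flow in \<open>x\<close>, let \<open>x n\<close> tend to \<open>p\<close> along
  \<open>u\<close> in steps \<open>s n\<close> and divide \<open>\<Gamma> (x n) \<sigma> - x n = \<integral> X\<close> by \<open>s n\<close>. The left-hand side tends to zero by
  degeneracy. The integrands converge pointwise to the Hessian term and are bounded by the Lipschitz
  estimate, so dominated convergence gives \<open>\<integral> D \<tau> p u \<bullet> v d\<tau> = 0\<close> over every initial interval.\<close>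

lemma hessian_eq_0:
  assumes t: "t \<in> {0..1}"
  shows "D t p u \<bullet> v = 0"
proof -
  have lin: "linear (\<lambda>w. \<Omega> p w v)" using \<Omega>_bilinear[OF p_in] by (simp add: bilinear_def)
  then have blin: "bounded_linear (\<lambda>w. \<Omega> p w v)" by (rule linear_conv_bounded_linear[THEN iffD1])
  then obtain B where B: "\<And>w. norm (\<Omega> p w v) \<le> norm w * B" "0 \<le> B"
    using bounded_linear.nonneg_bounded by blast
  define s where "s n = \<delta> / (norm u + 1) / real (Suc n)" for n
  have c: "0 < \<delta> / (norm u + 1)" 
    by (rule divide_pos_pos) (use \<delta>_pos norm_ge_zero[of u] in linarith)+
  have s_pos: "0 < s n" for n using c unfolding s_def by (rule divide_pos_pos) simp
  have s_lim: "s \<longlonglongrightarrow> 0"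
    unfolding s_def by (rule lim_const_over_n[THEN LIMSEQ_Suc])
  have x_ball: "p + s n *\<^sub>R u \<in> ball p \<delta>" for n
  proof -
    have "s n \<le> \<delta> / (norm u + 1)"
      using divide_left_mono[of 1 "real (Suc n)" "\<delta> / (norm u + 1)"] c by (simp add: s_def)
    then have "s n * norm u \<le> \<delta> / (norm u + 1) * norm u" by (rule mult_right_mono) simp
    also have "\<dots> < \<delta>"
      using \<delta>_pos norm_ge_zero[of u] by (simp add: field_simps del: norm_ge_zero)
    finally show ?thesis using s_pos[of n] by (simp add: dist_norm)
  qed
  define x where "x n = p + s n *\<^sub>R u" for n
  note x = x_ball[folded x_def]
  have line: "((\<lambda>s. p + s *\<^sub>R u) has_vector_derivative u) (at 0)"
    by (auto intro!: derivative_eq_intros)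
  have dist_x: "norm (\<Gamma> (x n) \<tau> - p) \<le> exp L * (s n * norm u)" if "\<tau> \<in> {0..1}" for n \<tau>
    using \<Gamma>_lipschitz[OF x p_ball that, of n] s_pos[of n] \<Gamma>_p[OF that] by (simp add: x_def)
  have X_x: "norm (X \<tau> (\<Gamma> (x n) \<tau>)) \<le> L * (exp L * (s n * norm u))" if "\<tau> \<in> {0..1}" for n \<tau>
    using X_lip[OF that \<Gamma>_in[OF x that] p_in, of n] mult_left_mono[OF dist_x[OF that, of n] L_nonneg]
    by (simp add: X_p[OF that])
  have s_ne: "s n \<noteq> 0" for n using s_pos[of n] by simp
  have quot: "(\<lambda>n. f (s n) / s n) \<longlonglongrightarrow> f'" if f: "(f has_real_derivative f') (at 0)" "f 0 = 0" for f f'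
  proof -
    have "((\<lambda>y. f y / y) \<longlongrightarrow> f') (at 0)"
      using f by (simp add: has_field_derivative_iff)
    then have "((\<lambda>y. f y / y) \<circ> s) \<longlonglongrightarrow> f'"
      by (simp add: tendsto_at_iff_sequentially s_ne s_lim)
    then show ?thesis by (simp add: o_def)
  qed
  \<comment> \<open>Difference quotients of the velocity, tested against \<open>v\<close> with the form at the fixed point \<open>p\<close> so
    that the form commutes with the integral over time.\<close>
  define q where "q n \<tau> = \<Omega> p (X \<tau> (\<Gamma> (x n) \<tau>)) v / s n" for n \<tau>
  have q_cont: "continuous_on {0..1} (q n)" for n
    unfolding q_def
    by (intro continuous_intros bounded_linear.continuous_on[OF blin] along_\<Gamma>_cont[OF x X_cont])
      (use s_pos[of n] in auto)
  have q_lim: "(\<lambda>n. q n \<tau>) \<longlonglongrightarrow> D \<tau> p u \<bullet> v" if \<tau>: "\<tau> \<in> {0..1}" for \<tau>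
  proof -
    have "((\<lambda>x. G \<tau> (\<Gamma> x \<tau>)) has_derivative (\<lambda>u. D \<tau> p u)) (at p)"
      using has_derivative_compose[OF \<Gamma>_degenerate[OF \<tau>], of "G \<tau>" "D \<tau> p"]
        G_deriv[OF \<tau> p_in] by (simp add: \<Gamma>_p[OF \<tau>] at_p)
    then have "((\<lambda>s. G \<tau> (\<Gamma> (p + s *\<^sub>R u) \<tau>)) has_vector_derivative D \<tau> p u) (at 0)"
      using vector_derivative_diff_chain_within[OF line, of "\<lambda>x. G \<tau> (\<Gamma> x \<tau>)" "D \<tau> p"]
      by (auto simp: o_def intro: has_derivative_at_withinI)
    then have "((\<lambda>s. G \<tau> (\<Gamma> (p + s *\<^sub>R u) \<tau>) \<bullet> v) has_vector_derivative D \<tau> p u \<bullet> v) (at 0)"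
      by (rule bounded_linear.has_vector_derivative[OF bounded_linear_inner_left])
    then have "(\<lambda>n. (G \<tau> (\<Gamma> (x n) \<tau>) \<bullet> v) / s n) \<longlonglongrightarrow> D \<tau> p u \<bullet> v"
      unfolding x_def
      by (intro quot) (simp_all add: has_real_derivative_iff_has_vector_derivative \<Gamma>_p[OF \<tau>] G_p[OF \<tau>])
    moreover have "(\<lambda>n. (\<Omega> (\<Gamma> (x n) \<tau>) (X \<tau> (\<Gamma> (x n) \<tau>)) v - \<Omega> p (X \<tau> (\<Gamma> (x n) \<tau>)) v) / s n) \<longlonglongrightarrow> 0"
    proof (rule Lim_null_comparison)
      let ?c = "\<kappa> * (exp L * norm u) * (L * (exp L * norm u)) * norm v"
      show "(\<lambda>n. ?c * s n) \<longlonglongrightarrow> 0"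
        using tendsto_mult_right_zero[OF s_lim] by simp
      show "\<forall>\<^sub>F n in sequentially. norm ((\<Omega> (\<Gamma> (x n) \<tau>) (X \<tau> (\<Gamma> (x n) \<tau>)) v -
          \<Omega> p (X \<tau> (\<Gamma> (x n) \<tau>)) v) / s n) \<le> ?c * s n"
      proof (rule always_eventually, rule allI)
        fix n
        have "\<bar>\<Omega> (\<Gamma> (x n) \<tau>) (X \<tau> (\<Gamma> (x n) \<tau>)) v - \<Omega> p (X \<tau> (\<Gamma> (x n) \<tau>)) v\<bar>
            \<le> \<kappa> * norm (\<Gamma> (x n) \<tau> - p) * norm (X \<tau> (\<Gamma> (x n) \<tau>)) * norm v"
          by (intro \<Omega>_lipschitz \<Gamma>_in x \<tau> p_in)
        also have "\<dots> \<le> \<kappa> * (exp L * (s n * norm u)) * (L * (exp L * (s n * norm u))) * norm v"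
          using dist_x[OF \<tau>, of n] X_x[OF \<tau>, of n] \<kappa>_nonneg s_pos[of n]
          by (intro mult_right_mono mult_mono) auto
        also have "\<dots> = ?c * s n * s n" by (simp add: ac_simps)
        finally show "norm ((\<Omega> (\<Gamma> (x n) \<tau>) (X \<tau> (\<Gamma> (x n) \<tau>)) v -
          \<Omega> p (X \<tau> (\<Gamma> (x n) \<tau>)) v) / s n) \<le> ?c * s n"
          using s_pos[of n] by (simp add: divide_le_eq)
      qed
    qed
    ultimately have "(\<lambda>n. (G \<tau> (\<Gamma> (x n) \<tau>) \<bullet> v) / s n -
        (\<Omega> (\<Gamma> (x n) \<tau>) (X \<tau> (\<Gamma> (x n) \<tau>)) v - \<Omega> p (X \<tau> (\<Gamma> (x n) \<tau>)) v) / s n) \<longlonglongrightarrow> D \<tau> p u \<bullet> v - 0"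
      by (rule tendsto_diff)
    moreover have "\<Omega> (\<Gamma> (x n) \<tau>) (X \<tau> (\<Gamma> (x n) \<tau>)) v = G \<tau> (\<Gamma> (x n) \<tau>) \<bullet> v" for n
      by (rule X[OF \<tau> \<Gamma>_in[OF x \<tau>]])
    ultimately show ?thesis
      by (simp add: q_def diff_divide_distrib)
  qed
  have int0: "integral {0..\<sigma>} (\<lambda>\<tau>. D \<tau> p u \<bullet> v) = 0" if \<sigma>: "\<sigma> \<in> {0..1}" for \<sigma>
  proof (rule LIMSEQ_unique)
    have sub: "{0..\<sigma>} \<subseteq> {0..1}" using \<sigma> by auto
    show "(\<lambda>n. integral {0..\<sigma>} (q n)) \<longlonglongrightarrow> integral {0..\<sigma>} (\<lambda>\<tau>. D \<tau> p u \<bullet> v)"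
    proof (rule dominated_convergence(2))
      show "q n integrable_on {0..\<sigma>}" for n
        by (intro integrable_continuous_interval continuous_on_subset[OF q_cont sub])
      show "(\<lambda>_. L * (exp L * norm u) * B) integrable_on {0..\<sigma>}"
        by (rule integrable_const_ivl)
      show "norm (q n \<tau>) \<le> L * (exp L * norm u) * B" if "\<tau> \<in> {0..\<sigma>}" for n \<tau>
      proof -
        have \<tau>: "\<tau> \<in> {0..1}" using that sub by auto
        have "norm (\<Omega> p (X \<tau> (\<Gamma> (x n) \<tau>)) v) \<le> norm (X \<tau> (\<Gamma> (x n) \<tau>)) * B" by (rule B)
        also have "\<dots> \<le> L * (exp L * (s n * norm u)) * B"
          using X_x[OF \<tau>] B(2) by (rule mult_right_mono)
        finally show ?thesis
          using s_pos[of n] by (simp add: q_def divide_le_eq ac_simps)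
      qed
      show "(\<lambda>n. q n \<tau>) \<longlonglongrightarrow> D \<tau> p u \<bullet> v" if "\<tau> \<in> {0..\<sigma>}" for \<tau>
        using q_lim that sub by auto
    qed
    have "integral {0..\<sigma>} (q n) = (\<Omega> p (\<Gamma> (x n) \<sigma>) v - \<Omega> p p v - s n * \<Omega> p u v) / s n" for n
    proof -
      have "(q n has_integral \<Omega> p (\<Gamma> (x n) \<sigma>) v / s n - \<Omega> p (\<Gamma> (x n) 0) v / s n) {0..\<sigma>}"
      proof (rule fundamental_theorem_of_calculus)
        fix \<tau> assume "\<tau> \<in> {0..\<sigma>}"
        then have "(\<Gamma> (x n) has_vector_derivative X \<tau> (\<Gamma> (x n) \<tau>)) (at \<tau> within {0..\<sigma>})"
          using sub by (intro has_vector_derivative_within_subset[OF \<Gamma>_deriv[OF x]]) auto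
        then show "((\<lambda>\<tau>. \<Omega> p (\<Gamma> (x n) \<tau>) v / s n) has_vector_derivative q n \<tau>) (at \<tau> within {0..\<sigma>})"
          unfolding q_def divide_inverse
          by (intro has_vector_derivative_mult_left bounded_linear.has_vector_derivative[OF blin])
      qed (use \<sigma> in simp)
      then have "integral {0..\<sigma>} (q n) = \<Omega> p (\<Gamma> (x n) \<sigma>) v / s n - \<Omega> p (\<Gamma> (x n) 0) v / s n"
        by (rule integral_unique)
      also have "\<Omega> p (\<Gamma> (x n) 0) v = \<Omega> p p v + s n * \<Omega> p u v"
        using linear_add[OF lin, of p "s n *\<^sub>R u"] linear_scale[OF lin, of "s n" u]
        unfolding \<Gamma>_0[OF x] by (simp add: x_def)
      finally show ?thesis by (simp add: diff_divide_distrib add_divide_distrib)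
    qed
    moreover have "(\<lambda>n. (\<Omega> p (\<Gamma> (x n) \<sigma>) v - \<Omega> p p v - s n * \<Omega> p u v) / s n) \<longlonglongrightarrow> 0"
      unfolding x_def
    proof (rule quot)
      have "((\<lambda>s. \<Gamma> (p + s *\<^sub>R u) \<sigma>) has_vector_derivative u) (at 0)"
        using vector_derivative_diff_chain_within[OF line, of "\<lambda>x. \<Gamma> x \<sigma>" "\<lambda>u. u"] \<Gamma>_degenerate[OF \<sigma>]
        by (auto simp: o_def intro: has_derivative_at_withinI)
      then have "((\<lambda>s. \<Omega> p (\<Gamma> (p + s *\<^sub>R u) \<sigma>) v) has_vector_derivative \<Omega> p u v) (at 0)"
        by (rule bounded_linear.has_vector_derivative[OF blin])
      then show "((\<lambda>s. \<Omega> p (\<Gamma> (p + s *\<^sub>R u) \<sigma>) v - \<Omega> p p v - s * \<Omega> p u v) has_real_derivative 0) (at 0)"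
        unfolding has_real_derivative_iff_has_vector_derivative[symmetric]
        by (auto intro!: derivative_eq_intros)
    qed (simp add: \<Gamma>_p[OF \<sigma>])
    ultimately show "(\<lambda>n. integral {0..\<sigma>} (q n)) \<longlonglongrightarrow> 0" by simp
  qed
  have W: "continuous_on {0..1} (\<lambda>\<tau>. D \<tau> p u \<bullet> v)"
    by (intro continuous_intros continuous_on_eq[OF along_\<Gamma>_cont[OF p_ball D_cont[of u]]])
      (simp add: \<Gamma>_p)
  have "((\<lambda>\<sigma>. integral {0..\<sigma>} (\<lambda>\<tau>. D \<tau> p u \<bullet> v)) has_vector_derivative D t p u \<bullet> v) (at t within {0..1})"
    by (rule integral_has_vector_derivative[OF W t])
  then have "((\<lambda>\<sigma>. 0) has_vector_derivative D t p u \<bullet> v) (at t within {0..1})"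
    by (rule has_vector_derivative_transform[OF t, rotated]) (simp add: int0)
  then show ?thesis
    using vector_derivative_unique_within_closed_interval[of 0 1 t "\<lambda>_. 0" "D t p u \<bullet> v" 0] t by simp
qed

end

section \<open>The action argument\<close>

context hamiltonian_loops
begin

text \<open>The classical action functional, evaluated at the orbit of \<open>x\<close>. The sign of \<open>h\<close> belongs to the
  convention \<open>\<Omega>(X, \<cdot>) = dh\<close>.\<close>

definition action :: "'e \<Rightarrow> real" where
  "action x = integral {0..1} (\<lambda>t. lam (\<Gamma> x t) \<bullet> X t (\<Gamma> x t) + h t (\<Gamma> x t))"

lemma lam_cont: "continuous_on (cball p r) lam"
  unfolding continuous_on_eq_continuous_within
  using lam_deriv has_derivative_continuous by blast

text \<open>The primitive does not depend on time; the one-point parameter space makes the uniform estimates for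
  families apply to it.\<close>

lemma Dlam_cont_family: "continuous_on ({0::real} \<times> cball p r) (\<lambda>(t, x). Dlam x u)"
  unfolding case_prod_beta
  by (rule continuous_on_compose2[OF Dlam_cont]) (auto intro!: continuous_intros)

lemma lam_lipschitz:
  obtains N where "N \<ge> 0"
    "\<And>x y. x \<in> cball p r \<Longrightarrow> y \<in> cball p r \<Longrightarrow> norm (lam x - lam y) \<le> N * norm (x - y)"
proof -
  obtain N where "N \<ge> 0" and N: "\<And>t x y. t \<in> {0::real} \<Longrightarrow> x \<in> cball p r \<Longrightarrow> y \<in> cball p r \<Longrightarrow>
      norm (lam x - lam y) \<le> N * norm (x - y)"
    using lipschitz_on_compact[of "{0::real}" "cball p r" "\<lambda>_. lam" "\<lambda>_. Dlam", OF compact_sing compact_cball convex_cball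
        lam_deriv Dlam_cont_family] by blast
  then show ?thesis
    by (intro that[of N] N[of 0]) simp_all
qed

lemma lam_taylor:
  assumes "e > 0"
  obtains d where "d > 0" "\<And>x y. x \<in> cball p r \<Longrightarrow> y \<in> cball p r \<Longrightarrow> dist x y < d \<Longrightarrow>
      norm (lam y - lam x - Dlam x (y - x)) \<le> e * norm (y - x)"
proof -
  obtain d where "d > 0" and d: "\<And>t x y. t \<in> {0::real} \<Longrightarrow> x \<in> cball p r \<Longrightarrow> y \<in> cball p r \<Longrightarrow> dist x y < d \<Longrightarrow>
      norm (lam y - lam x - Dlam x (y - x)) \<le> e * norm (y - x)"
    using uniform_taylor[of "{0::real}" "cball p r" "\<lambda>_. lam" "\<lambda>_. Dlam", OF compact_sing compact_cball convex_cball
        lam_deriv Dlam_cont_family assms] by blast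
  then show ?thesis
    by (intro that[of d] d[of 0]) simp_all
qed

lemma h_taylor:
  assumes "e > 0"
  obtains d where "d > 0" "\<And>t x y. t \<in> {0..1} \<Longrightarrow> x \<in> cball p r \<Longrightarrow> y \<in> cball p r \<Longrightarrow> dist x y < d \<Longrightarrow>
      norm (h t y - h t x - G t x \<bullet> (y - x)) \<le> e * norm (y - x)"
proof -
  have "continuous_on ({0..1} \<times> cball p r) (\<lambda>(t, x). G t x \<bullet> u)" for u
    using G_cont unfolding case_prod_beta by (intro continuous_intros)
  from uniform_taylor[OF compact_Icc compact_cball convex_cball h_deriv this assms]
  show ?thesis using that by blast
qed

lemma h_p_cont: "continuous_on {0..1} (\<lambda>t. h t p)"
  by (rule continuous_on_eq[OF along_\<Gamma>_cont[OF p_ball h_cont]]) (simp add: \<Gamma>_p)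

lemma lam_\<Gamma>_cont: "x \<in> ball p \<delta> \<Longrightarrow> continuous_on {0..1} (\<lambda>t. lam (\<Gamma> x t))"
  by (rule continuous_on_compose2[OF lam_cont \<Gamma>_cont]) (use \<Gamma>_in in auto)

lemma lam_X_cont: "x \<in> ball p \<delta> \<Longrightarrow> continuous_on {0..1} (\<lambda>t. lam (\<Gamma> x t) \<bullet> X t (\<Gamma> x t))"
  by (intro continuous_intros lam_\<Gamma>_cont along_\<Gamma>_cont X_cont)

lemma action_integrable:
  "x \<in> ball p \<delta> \<Longrightarrow> (\<lambda>t. lam (\<Gamma> x t) \<bullet> X t (\<Gamma> x t) + h t (\<Gamma> x t)) integrable_on {0..1}"
  by (intro integrable_continuous_interval continuous_on_add lam_X_cont along_\<Gamma>_cont h_cont)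

text \<open>Orbits are critical points of the action. For two orbits with difference \<open>\<eta>\<close> the first-order terms of
  the difference of the integrands form, up to the total derivative of \<open>lam (\<Gamma> x) \<bullet> \<eta>\<close>, the expression
  \<open>\<Omega>(\<eta>, X) + dh(\<eta>) = 0\<close>; the total derivative integrates to zero over closed orbits. What remains is
  of smaller order than \<open>\<eta>\<close>, and \<open>\<eta>\<close> is bounded by the distance of the initial points.\<close>

lemma action_deriv:
  assumes x: "x \<in> ball p \<delta>"
  shows "(action has_derivative (\<lambda>_. 0)) (at x within ball p \<delta>)"
  unfolding has_derivative_within_alt
proof (intro conjI allI impI)
  show "bounded_linear (\<lambda>_::'e. 0::real)" by simp
  fix e :: real assume "e > 0"
  let ?K = "cball p r"
  obtain M where M: "M \<ge> 0" "\<And>t x. t \<in> {0..1} \<Longrightarrow> x \<in> ?K \<Longrightarrow> norm (X t x) \<le> M"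
    using X_bounded by blast
  obtain N where N: "N \<ge> 0"
    "\<And>x y. x \<in> ?K \<Longrightarrow> y \<in> ?K \<Longrightarrow> norm (lam x - lam y) \<le> N * norm (x - y)"
    using lam_lipschitz by blast
  define E where "E = exp L"
  have E: "E > 0" by (simp add: E_def)
  \<comment> \<open>Each of the two kinds of error terms below is allowed half of \<open>e\<close>.\<close>
  define e1 where "e1 = e / (2 * E * (M + 1))"
  have e1: "e1 > 0" using \<open>e > 0\<close> E M(1) by (simp add: e1_def)
  obtain d1 where d1: "d1 > 0" "\<And>x y. x \<in> ?K \<Longrightarrow> y \<in> ?K \<Longrightarrow> dist x y < d1 \<Longrightarrow>
      norm (lam y - lam x - Dlam x (y - x)) \<le> e1 * norm (y - x)"
    using lam_taylor[OF e1] by blast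
  obtain d2 where d2: "d2 > 0" "\<And>t x y. t \<in> {0..1} \<Longrightarrow> x \<in> ?K \<Longrightarrow> y \<in> ?K \<Longrightarrow> dist x y < d2 \<Longrightarrow>
      norm (h t y - h t x - G t x \<bullet> (y - x)) \<le> e1 * norm (y - x)"
    using h_taylor[OF e1] by blast
  define d where "d = min (min d1 d2 / E) (e / (2 * E * (N * L * E + 1)))"
  have d: "d > 0" using d1(1) d2(1) E \<open>e > 0\<close> N(1) L_nonneg
    by (auto simp: d_def intro!: divide_pos_pos mult_pos_pos add_nonneg_pos)
  show "\<exists>d>0. \<forall>y\<in>ball p \<delta>. norm (y - x) < d \<longrightarrow> norm (action y - action x - 0) \<le> e * norm (y - x)"
  proof (intro exI[of _ d] conjI ballI impI d)
    fix y assume y: "y \<in> ball p \<delta>" and yx: "norm (y - x) < d"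
    define \<eta> where "\<eta> t = \<Gamma> y t - \<Gamma> x t" for t
    have \<eta>: "norm (\<eta> t) \<le> E * norm (y - x)" if "t \<in> {0..1}" for t
      unfolding \<eta>_def E_def by (rule \<Gamma>_lipschitz[OF y x that])
    have \<eta>_small: "norm (\<eta> t) < d1" "norm (\<eta> t) < d2" if "t \<in> {0..1}" for t
    proof -
      have "E * norm (y - x) < min d1 d2"
        using yx E by (simp add: d_def pos_less_divide_eq mult.commute)
      with \<eta>[OF that] show "norm (\<eta> t) < d1" "norm (\<eta> t) < d2" by auto
    qed
    \<comment> \<open>The total derivative of \<open>lam (\<Gamma> x t) \<bullet> \<eta> t\<close>.\<close>
    define P where "P t = lam (\<Gamma> x t) \<bullet> (X t (\<Gamma> y t) - X t (\<Gamma> x t)) + Dlam (\<Gamma> x t) (X t (\<Gamma> x t)) \<bullet> \<eta> t" for t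
    have "(P has_integral lam (\<Gamma> x 1) \<bullet> \<eta> 1 - lam (\<Gamma> x 0) \<bullet> \<eta> 0) {0..1}"
    proof (rule fundamental_theorem_of_calculus)
      fix t :: real assume t: "t \<in> {0..1}"
      have "((lam \<circ> \<Gamma> x) has_vector_derivative Dlam (\<Gamma> x t) (X t (\<Gamma> x t))) (at t within {0..1})"
        by (rule vector_derivative_diff_chain_within[OF \<Gamma>_deriv[OF x t]], rule has_derivative_subset[OF lam_deriv])
          (use \<Gamma>_in x t in auto)
      moreover have "(\<eta> has_vector_derivative X t (\<Gamma> y t) - X t (\<Gamma> x t)) (at t within {0..1})"
        unfolding \<eta>_def[abs_def] by (intro has_vector_derivative_diff \<Gamma>_deriv x y t)
      ultimately show "((\<lambda>t. lam (\<Gamma> x t) \<bullet> \<eta> t) has_vector_derivative P t) (at t within {0..1})"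
        unfolding P_def o_def
        by (rule bounded_bilinear.has_vector_derivative[OF bounded_bilinear_inner])
    qed simp
    then have P: "(P has_integral 0) {0..1}"
      by (simp add: \<eta>_def \<Gamma>_0[OF x] \<Gamma>_1[OF x] \<Gamma>_0[OF y] \<Gamma>_1[OF y])
    let ?I = "\<lambda>x t. lam (\<Gamma> x t) \<bullet> X t (\<Gamma> x t) + h t (\<Gamma> x t)"
    have "((\<lambda>t. ?I y t - ?I x t - P t) has_integral action y - action x - 0) {0..1}"
      unfolding action_def
      by (intro has_integral_diff P integrable_integral action_integrable x y)
    moreover have bound: "norm (?I y t - ?I x t - P t) \<le> e * norm (y - x)" if t: "t \<in> {0..1}" for t
    proof -
      let ?a = "\<Gamma> x t" and ?b = "\<Gamma> y t"
      have ab: "?a \<in> ?K" "?b \<in> ?K" using \<Gamma>_in x y t by auto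
      have small: "dist ?a ?b < d1" "dist ?a ?b < d2"
        using \<eta>_small[OF t] by (simp_all add: \<eta>_def dist_norm norm_minus_commute)
      \<comment> \<open>Hamilton's equation for \<open>\<Gamma> x\<close>, that is, the vanishing of the first variation.\<close>
      have cancel: "Dlam ?a (\<eta> t) \<bullet> X t ?a - Dlam ?a (X t ?a) \<bullet> \<eta> t + G t ?a \<bullet> \<eta> t = 0"
        using Dlam_skew[OF ab(1), of "\<eta> t" "X t ?a"] X[OF t ab(1), of "\<eta> t"]
          \<Omega>_skew[OF ab(1), of "\<eta> t" "X t ?a"] by simp
      have "?I y t - ?I x t - P t = (lam ?b - lam ?a - Dlam ?a (\<eta> t)) \<bullet> X t ?a
          + (lam ?b - lam ?a) \<bullet> (X t ?b - X t ?a) + (h t ?b - h t ?a - G t ?a \<bullet> \<eta> t)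
          + (Dlam ?a (\<eta> t) \<bullet> X t ?a - Dlam ?a (X t ?a) \<bullet> \<eta> t + G t ?a \<bullet> \<eta> t)"
        by (simp add: P_def inner_diff_left inner_diff_right)
      then have "norm (?I y t - ?I x t - P t) \<le> norm ((lam ?b - lam ?a - Dlam ?a (\<eta> t)) \<bullet> X t ?a)
          + norm ((lam ?b - lam ?a) \<bullet> (X t ?b - X t ?a)) + norm (h t ?b - h t ?a - G t ?a \<bullet> \<eta> t)"
        unfolding cancel real_norm_def by linarith
      also have "\<dots> \<le> e1 * norm (\<eta> t) * M + (N * norm (\<eta> t)) * (L * norm (\<eta> t)) + e1 * norm (\<eta> t)"
      proof (intro add_mono)
        have "norm ((lam ?b - lam ?a - Dlam ?a (\<eta> t)) \<bullet> X t ?a)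
            \<le> norm (lam ?b - lam ?a - Dlam ?a (\<eta> t)) * norm (X t ?a)"
          by (simp add: Cauchy_Schwarz_ineq2)
        also have "\<dots> \<le> e1 * norm (\<eta> t) * M"
          using d1(2)[OF ab small(1)] M(2)[OF t ab(1)] e1
          by (intro mult_mono) (auto simp: \<eta>_def)
        finally show "norm ((lam ?b - lam ?a - Dlam ?a (\<eta> t)) \<bullet> X t ?a) \<le> e1 * norm (\<eta> t) * M" .
        have "norm ((lam ?b - lam ?a) \<bullet> (X t ?b - X t ?a)) \<le> norm (lam ?b - lam ?a) * norm (X t ?b - X t ?a)"
          by (simp add: Cauchy_Schwarz_ineq2)
        also have "\<dots> \<le> (N * norm (\<eta> t)) * (L * norm (\<eta> t))"
          using N(2)[OF ab(2,1)] X_lip[OF t ab(2,1)] N(1)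
          by (intro mult_mono) (auto simp: \<eta>_def)
        finally show "norm ((lam ?b - lam ?a) \<bullet> (X t ?b - X t ?a)) \<le> (N * norm (\<eta> t)) * (L * norm (\<eta> t))" .
        show "norm (h t ?b - h t ?a - G t ?a \<bullet> \<eta> t) \<le> e1 * norm (\<eta> t)"
          unfolding \<eta>_def by (rule d2(2)[OF t ab small(2)])
      qed
      also have "\<dots> = (e1 * (M + 1) + N * L * norm (\<eta> t)) * norm (\<eta> t)" by (simp add: algebra_simps)
      also have "\<dots> \<le> (e1 * (M + 1) + (N * L * E + 1) * norm (y - x)) * (E * norm (y - x))"
      proof (rule mult_mono[OF add_left_mono \<eta>[OF t]])
        have "N * L * norm (\<eta> t) \<le> N * L * (E * norm (y - x))"
          using N(1) L_nonneg by (intro mult_left_mono \<eta>[OF t]) auto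
        also have "\<dots> \<le> (N * L * E + 1) * norm (y - x)"
          by (simp add: algebra_simps)
        finally show "N * L * norm (\<eta> t) \<le> (N * L * E + 1) * norm (y - x)" .
        show "0 \<le> e1 * (M + 1) + (N * L * E + 1) * norm (y - x)"
          using e1 M(1) N(1) L_nonneg E by (intro add_nonneg_nonneg mult_nonneg_nonneg) auto
      qed simp
      also have "\<dots> \<le> (e / (2 * E) + e / (2 * E)) * (E * norm (y - x))"
      proof (intro mult_right_mono add_mono)
        show "e1 * (M + 1) \<le> e / (2 * E)" using M(1) by (simp add: e1_def)
        have pos: "0 < N * L * E + 1" using N(1) L_nonneg E by (intro add_nonneg_pos) auto
        have "norm (y - x) \<le> e / (2 * E * (N * L * E + 1))" using yx by (simp add: d_def)
        then have "(N * L * E + 1) * norm (y - x) \<le> (N * L * E + 1) * (e / (2 * E * (N * L * E + 1)))"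
          using pos by (intro mult_left_mono) auto
        also have "\<dots> = e / (2 * E)" using pos by simp
        finally show "(N * L * E + 1) * norm (y - x) \<le> e / (2 * E)" .
      qed (use E in simp)
      also have "\<dots> = e * norm (y - x)" using E by simp
      finally show ?thesis .
    qed
    ultimately show "norm (action y - action x - 0) \<le> e * norm (y - x)"
      using has_integral_bound_real[of "e * norm (y - x)" "{}" "\<lambda>t. ?I y t - ?I x t - P t" "action y - action x - 0" 0 1]
        \<open>e > 0\<close> bound by simp
  qed
qed

lemma action_eq:
  assumes x: "x \<in> ball p \<delta>"
  shows "integral {0..1} (\<lambda>t. lam (\<Gamma> x t) \<bullet> X t (\<Gamma> x t)) = integral {0..1} (\<lambda>t. h t p - h t (\<Gamma> x t))"
proof -
  have "\<exists>c. \<forall>x\<in>ball p \<delta>. action x = c"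
    by (rule has_derivative_zero_constant[OF convex_ball action_deriv])
  then have "action x = action p" using x p_ball by metis
  also have "\<dots> = integral {0..1} (\<lambda>t. h t p)"
    unfolding action_def by (rule integral_cong) (simp add: \<Gamma>_p X_p)
  finally have "action x = integral {0..1} (\<lambda>t. h t p)" .
  moreover have "action x = integral {0..1} (\<lambda>t. lam (\<Gamma> x t) \<bullet> X t (\<Gamma> x t)) + integral {0..1} (\<lambda>t. h t (\<Gamma> x t))"
    unfolding action_def
    by (intro integral_add integrable_continuous_interval lam_X_cont along_\<Gamma>_cont h_cont x)
  moreover have "integral {0..1} (\<lambda>t. h t p - h t (\<Gamma> x t)) = integral {0..1} (\<lambda>t. h t p) - integral {0..1} (\<lambda>t. h t (\<Gamma> x t))"
    by (intro integral_diff integrable_continuous_interval along_\<Gamma>_cont h_cont h_p_cont x)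
  ultimately show ?thesis by simp
qed

lemma G_small_lipschitz:
  assumes "\<epsilon> > 0"
  obtains \<rho> where "0 < \<rho>" "\<rho> \<le> r"
    "\<And>t x y. t \<in> {0..1} \<Longrightarrow> x \<in> cball p \<rho> \<Longrightarrow> y \<in> cball p \<rho> \<Longrightarrow> norm (G t x - G t y) \<le> \<epsilon> * norm (x - y)"
proof -
  have "D t p u = 0" if "t \<in> {0..1}" for t u
    using hessian_eq_0[OF that, of u "D t p u"] by simp
  then have Dp: "(\<Sum>i\<in>Basis. norm (D t p i)) = 0" if "t \<in> {0..1}" for t
    using that by simp
  have "continuous_on ({0..1} \<times> cball p r) (\<lambda>(t, x). \<Sum>i\<in>Basis. norm (D t x i))"
    using D_cont unfolding case_prod_beta by (intro continuous_intros)
  then have "uniformly_continuous_on ({0..1} \<times> cball p r) (\<lambda>(t, x). \<Sum>i\<in>Basis. norm (D t x i))"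
    by (intro compact_uniformly_continuous compact_Times compact_Icc compact_cball)
  then obtain d where "d > 0" and d: "\<And>z z'. z \<in> {0..1} \<times> cball p r \<Longrightarrow> z' \<in> {0..1} \<times> cball p r \<Longrightarrow> dist z' z < d \<Longrightarrow>
      dist ((\<lambda>(t, x). \<Sum>i\<in>Basis. norm (D t x i)) z') ((\<lambda>(t, x). \<Sum>i\<in>Basis. norm (D t x i)) z) < \<epsilon>"
    unfolding uniformly_continuous_on_def using \<open>\<epsilon> > 0\<close> by metis
  define \<rho> where "\<rho> = min r (d / 2)"
  have \<rho>: "0 < \<rho>" "\<rho> \<le> r" using r_pos \<open>d > 0\<close> by (auto simp: \<rho>_def)
  show ?thesis
  proof (rule that[OF \<rho>])
    fix t :: real and x y assume t: "t \<in> {0..1}" and xy: "x \<in> cball p \<rho>" "y \<in> cball p \<rho>"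
    show "norm (G t x - G t y) \<le> \<epsilon> * norm (x - y)"
    proof (rule uniform_lipschitz[OF convex_cball _ _ t xy])
      fix t :: real and w assume t: "t \<in> {0..1}" and w: "w \<in> cball p \<rho>"
      have w': "w \<in> cball p r" using w \<rho> by auto
      show "(G t has_derivative D t w) (at w within cball p \<rho>)"
        by (rule has_derivative_subset[OF G_deriv[OF t w']]) (use \<rho> in auto)
      have "dist (t, w) (t, p) < d"
        using w \<open>d > 0\<close> by (simp add: dist_Pair_Pair \<rho>_def dist_commute)
      from d[OF _ _ this] show "(\<Sum>i\<in>Basis. norm (D t w i)) \<le> \<epsilon>"
        using t w' p_in Dp[OF t] by (simp add: dist_norm)
    qed
  qed
qed

text \<open>The integral of \<open>h t p - h t\<close> along an orbit equals the symplectic area of the orbit. The area is at most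
  a multiple of the squared length, and close to \<open>p\<close> this is at most half of the same integral, which
  is therefore zero.\<close>

theorem \<Gamma>_constant:
  obtains \<rho> where "\<rho> > 0"
    "\<And>x t. x \<in> ball p \<rho> \<Longrightarrow> t \<in> {0..1} \<Longrightarrow> \<Gamma> x t = x \<and> h t x = h t p"
proof -
  obtain N where N: "N \<ge> 0"
    "\<And>x y. x \<in> cball p r \<Longrightarrow> y \<in> cball p r \<Longrightarrow> norm (lam x - lam y) \<le> N * norm (x - y)"
    using lam_lipschitz by blast
  \<comment> \<open>Chosen such that the final constant \<open>4 N C\<^sup>2 \<epsilon>\<close> is at most \<open>1 / 2\<close>.\<close>
  define \<epsilon> where "\<epsilon> = 1 / (8 * (N * C\<^sup>2 + 1))"
  have \<epsilon>: "\<epsilon> > 0" using N(1) by (auto simp: \<epsilon>_def intro!: add_nonneg_pos)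
  have NC\<epsilon>: "N * C\<^sup>2 * (4 * \<epsilon>) \<le> 1 / 2"
    using N(1) by (simp add: \<epsilon>_def divide_le_eq add_nonneg_pos)
  obtain \<rho> where \<rho>: "0 < \<rho>" "\<rho> \<le> r" and G_lip:
    "\<And>t x y. t \<in> {0..1} \<Longrightarrow> x \<in> cball p \<rho> \<Longrightarrow> y \<in> cball p \<rho> \<Longrightarrow> norm (G t x - G t y) \<le> \<epsilon> * norm (x - y)"
    by (rule G_small_lipschitz[OF \<epsilon>]) blast
  have sub: "cball p \<rho> \<subseteq> cball p r" using \<rho> by auto
  have G_sq: "(norm (G t y))\<^sup>2 \<le> 4 * \<epsilon> * (h t p - h t y)" if t: "t \<in> {0..1}" and y: "y \<in> cball p (\<rho> / 2)" for t y
  proof -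
    have "(norm (- G t y))\<^sup>2 \<le> 4 * \<epsilon> * (h t p - h t y)"
    proof (rule norm_gradient_squared_le[OF \<epsilon> _ _ _ _ y])
      fix x assume x: "x \<in> cball p \<rho>"
      have "((\<lambda>y. h t p - h t y) has_derivative (\<lambda>u. 0 - G t x \<bullet> u)) (at x within cball p \<rho>)"
        by (intro has_derivative_diff has_derivative_const has_derivative_subset[OF h_deriv sub]) (use t x sub in auto)
      then show "((\<lambda>y. h t p - h t y) has_derivative (\<lambda>u. - G t x \<bullet> u)) (at x within cball p \<rho>)"
        by simp
      show "0 \<le> h t p - h t x" using h_max[OF t] x sub by auto
      show "norm (- G t x - - G t y) \<le> \<epsilon> * norm (x - y)" if "y \<in> cball p \<rho>" for y
        using G_lip[OF t that x] by (simp add: norm_minus_commute)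
    qed (simp add: G_p[OF t])
    then show ?thesis by simp
  qed
  define \<rho>' where "\<rho>' = min \<delta> (\<rho> / (2 * exp L))"
  show ?thesis
  proof (rule that)
    show "\<rho>' > 0" using \<delta>_pos \<rho> by (simp add: \<rho>'_def)
    fix x and s :: real assume x': "x \<in> ball p \<rho>'" and s: "s \<in> {0..1}"
    then have x: "x \<in> ball p \<delta>" by (simp add: \<rho>'_def)
    have near: "\<Gamma> x t \<in> cball p (\<rho> / 2)" if t: "t \<in> {0..1}" for t
    proof -
      have "norm (\<Gamma> x t - p) \<le> exp L * norm (x - p)"
        using \<Gamma>_lipschitz[OF x p_ball t] by (simp add: \<Gamma>_p[OF t])
      also have "\<dots> \<le> exp L * (\<rho> / (2 * exp L))"
        using x' by (intro mult_left_mono) (auto simp: \<rho>'_def dist_norm norm_minus_commute)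
      finally show ?thesis by (simp add: dist_norm norm_minus_commute)
    qed
    define f where "f t = h t p - h t (\<Gamma> x t)" for t
    define v where "v t = norm (X t (\<Gamma> x t))" for t
    have v_cont: "continuous_on {0..1} v"
      unfolding v_def by (intro continuous_intros along_\<Gamma>_cont X_cont x)
    have f_cont: "continuous_on {0..1} f"
      unfolding f_def by (intro continuous_on_diff h_p_cont along_\<Gamma>_cont h_cont x)
    have f_nonneg: "0 \<le> f t" if "t \<in> {0..1}" for t
      using h_max[OF that \<Gamma>_in[OF x that]] by (simp add: f_def)
    have v_sq: "(v t)\<^sup>2 \<le> C\<^sup>2 * (4 * \<epsilon> * f t)" if t: "t \<in> {0..1}" for t
    proof -
      have "(v t)\<^sup>2 \<le> (C * norm (G t (\<Gamma> x t)))\<^sup>2"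
        using X_le[OF t \<Gamma>_in[OF x t]] by (intro power_mono) (auto simp: v_def)
      also have "\<dots> \<le> C\<^sup>2 * (4 * \<epsilon> * f t)"
        using G_sq[OF t near[OF t]] by (simp add: power_mult_distrib f_def mult_left_mono)
      finally show ?thesis .
    qed
    have v_int: "v integrable_on {0..1}" by (rule integrable_continuous_interval[OF v_cont])
    let ?S = "integral {0..1} v"
    have S_nonneg: "0 \<le> ?S" by (rule integral_nonneg[OF v_int]) (simp add: v_def)
    have displacement: "norm (\<Gamma> x t - x) \<le> ?S" if t: "t \<in> {0..1}" for t
    proof -
      have sub: "{0..t} \<subseteq> {0..1}" using t by auto
      have "((\<lambda>\<tau>. X \<tau> (\<Gamma> x \<tau>)) has_integral \<Gamma> x t - \<Gamma> x 0) {0..t}"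
        by (rule fundamental_theorem_of_calculus)
          (use t sub in \<open>auto intro!: has_vector_derivative_within_subset[OF \<Gamma>_deriv[OF x]]\<close>)
      then have "\<Gamma> x t - x = integral {0..t} (\<lambda>\<tau>. X \<tau> (\<Gamma> x \<tau>))"
        by (simp add: integral_unique \<Gamma>_0[OF x])
      also have "norm \<dots> \<le> integral {0..t} v"
        by (intro integral_norm_bound_integral integrable_continuous_interval
            continuous_on_subset[OF along_\<Gamma>_cont[OF x X_cont] sub] continuous_on_subset[OF v_cont sub])
          (simp add: v_def)
      also have "\<dots> \<le> ?S"
        by (intro integral_subset_le sub v_int integrable_continuous_interval continuous_on_subset[OF v_cont sub])
          (simp add: v_def)
      finally show ?thesis .
    qed
    have "integral {0..1} f = integral {0..1} (\<lambda>t. lam (\<Gamma> x t) \<bullet> X t (\<Gamma> x t))"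
      unfolding f_def by (rule action_eq[OF x, symmetric])
    \<comment> \<open>A constant 1-form integrates to zero over a loop; subtracting \<open>lam x\<close> makes the integrand quadratic
      in the size of the loop.\<close>
    also have "\<dots> = integral {0..1} (\<lambda>t. (lam (\<Gamma> x t) - lam x) \<bullet> X t (\<Gamma> x t))"
    proof -
      have "((\<lambda>\<tau>. X \<tau> (\<Gamma> x \<tau>)) has_integral \<Gamma> x 1 - \<Gamma> x 0) {0..1}"
        by (rule fundamental_theorem_of_calculus) (use \<Gamma>_deriv[OF x] in auto)
      then have "((\<lambda>\<tau>. X \<tau> (\<Gamma> x \<tau>)) has_integral 0) {0..1}"
        by (simp add: \<Gamma>_0[OF x] \<Gamma>_1[OF x])
      from has_integral_linear[OF this bounded_linear_inner_right[of "lam x"]]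
      have "((\<lambda>\<tau>. lam x \<bullet> X \<tau> (\<Gamma> x \<tau>)) has_integral lam x \<bullet> 0) {0..1}"
        by (simp add: o_def)
      then have "((\<lambda>t. lam (\<Gamma> x t) \<bullet> X t (\<Gamma> x t) - lam x \<bullet> X t (\<Gamma> x t)) has_integral
          integral {0..1} (\<lambda>t. lam (\<Gamma> x t) \<bullet> X t (\<Gamma> x t)) - lam x \<bullet> 0) {0..1}"
        by (intro has_integral_diff integrable_integral integrable_continuous_interval lam_X_cont x)
      then show ?thesis
        by (simp add: inner_diff_left integral_unique)
    qed
    also have "\<dots> \<le> integral {0..1} (\<lambda>t. N * ?S * v t)"
    proof (rule integral_le)
      show "(\<lambda>t. (lam (\<Gamma> x t) - lam x) \<bullet> X t (\<Gamma> x t)) integrable_on {0..1}"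
        by (intro integrable_continuous_interval continuous_intros lam_\<Gamma>_cont along_\<Gamma>_cont X_cont x)
      show "(\<lambda>t. N * ?S * v t) integrable_on {0..1}"
        by (intro integrable_continuous_interval continuous_intros v_cont)
      fix t :: real assume t: "t \<in> {0..1}"
      have "(lam (\<Gamma> x t) - lam x) \<bullet> X t (\<Gamma> x t) \<le> norm (lam (\<Gamma> x t) - lam x) * v t"
        unfolding v_def by (rule norm_cauchy_schwarz)
      also have "\<dots> \<le> (N * ?S) * v t"
      proof (rule mult_right_mono)
        have "norm (lam (\<Gamma> x t) - lam x) \<le> N * norm (\<Gamma> x t - x)"
          using \<Gamma>_in[OF x, of 0] by (intro N(2) \<Gamma>_in x t) (simp add: \<Gamma>_0[OF x])
        also have "\<dots> \<le> N * ?S" using N(1) displacement[OF t] by (rule mult_left_mono[rotated])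
        finally show "norm (lam (\<Gamma> x t) - lam x) \<le> N * ?S" .
      qed (simp add: v_def)
      finally show "(lam (\<Gamma> x t) - lam x) \<bullet> X t (\<Gamma> x t) \<le> N * ?S * v t" .
    qed
    also have "\<dots> = N * ?S\<^sup>2" by (simp add: power2_eq_square)
    also have "\<dots> \<le> N * integral {0..1} (\<lambda>t. (v t)\<^sup>2)"
      using N(1) by (intro mult_left_mono integral_power2_le v_cont)
    also have "\<dots> \<le> N * integral {0..1} (\<lambda>t. C\<^sup>2 * (4 * \<epsilon> * f t))"
      using N(1) v_sq
      by (intro mult_left_mono integral_le integrable_continuous_interval continuous_intros v_cont f_cont)
    also have "\<dots> = N * C\<^sup>2 * (4 * \<epsilon>) * integral {0..1} f" by simp
    also have "\<dots> \<le> 1 / 2 * integral {0..1} f"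
      using NC\<epsilon> f_nonneg by (intro mult_right_mono integral_nonneg integrable_continuous_interval f_cont)
    finally have "integral {0..1} f \<le> 0" by simp
    moreover have "0 \<le> integral {0..1} f"
      using f_nonneg by (intro integral_nonneg integrable_continuous_interval f_cont)
    ultimately have f0: "f t = 0" if "t \<in> {0..1}" for t
      using integral_eq_0_iff[OF f_cont zero_less_one f_nonneg] that by simp
    have "v t = 0" if "t \<in> {0..1}" for t
      using v_sq[OF that] f0[OF that] by simp
    then have "?S = 0" using integral_cong[of "{0..1}" v "\<lambda>_. 0"] by simp
    then have "\<Gamma> x s = x" using displacement[OF s] by simp
    moreover from this have "h s x = h s p" using f0[OF s] by (simp add: f_def)
    ultimately show "\<Gamma> x s = x \<and> h s x = h s p" ..
  qed
qed

end

section \<open>Charts and tangent vectors\<close>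

locale smooth_manifold =
  fixes A :: "('m::{t2_space,second_countable_topology}, 'e::euclidean_space) chart set"
  assumes atlas: "smooth_atlas A"
begin

lemma is_chart: "c \<in> A \<Longrightarrow> is_chart c"
  and UN_chart_dom: "(\<Union>c\<in>A. chart_dom c) = UNIV"
  and smooth_transition: "c \<in> A \<Longrightarrow> d \<in> A \<Longrightarrow>
    smooth_on (chart_map d \<circ> chart_inv c) (chart_map c ` (chart_dom c \<inter> chart_dom d))"
  using atlas unfolding smooth_atlas_def by simp_all

lemma chart_at: "\<exists>c. c \<in> charts_at A q"
proof -
  have "q \<in> (\<Union>c\<in>A. chart_dom c)" by (simp add: UN_chart_dom)
  then show ?thesis by (auto simp: charts_at_def)
qed

context
  fixes c :: "('m, 'e) chart"
  assumes c: "c \<in> A"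
begin

lemma chart_homeomorphism:
  "homeomorphism (chart_dom c) (chart_map c ` chart_dom c) (chart_map c) (chart_inv c)"
  using is_chart[OF c] by (simp add: is_chart_def)

lemma open_chart_dom: "open (chart_dom c)"
  and open_chart_image: "open (chart_map c ` chart_dom c)"
  using is_chart[OF c] by (simp_all add: is_chart_def)

lemma chart_inv_map: "q \<in> chart_dom c \<Longrightarrow> chart_inv c (chart_map c q) = q"
  using homeomorphism_apply1[OF chart_homeomorphism] .

lemma chart_map_inv: "x \<in> chart_map c ` chart_dom c \<Longrightarrow> chart_map c (chart_inv c x) = x"
  using homeomorphism_apply2[OF chart_homeomorphism] .

lemma chart_inv_in: "x \<in> chart_map c ` chart_dom c \<Longrightarrow> chart_inv c x \<in> chart_dom c"
  using homeomorphism_image2[OF chart_homeomorphism] by blast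

lemma chart_map_cont: "continuous_on (chart_dom c) (chart_map c)"
  using homeomorphism_cont1[OF chart_homeomorphism] .

lemma chart_inv_cont: "continuous_on (chart_map c ` chart_dom c) (chart_inv c)"
  using homeomorphism_cont2[OF chart_homeomorphism] .

lemma open_chart_inv_preimage: "open U \<Longrightarrow> open {x \<in> chart_map c ` chart_dom c. chart_inv c x \<in> U}"
  using continuous_open_preimage[OF chart_inv_cont open_chart_image, of U]
  by (simp add: vimage_def Int_def)

lemma open_chart_map_preimage: "open U \<Longrightarrow> open {q \<in> chart_dom c. chart_map c q \<in> U}"
  using continuous_open_preimage[OF chart_map_cont open_chart_dom, of U]
  by (simp add: vimage_def Int_def)

end

lemma charts_atD:
  assumes "c \<in> charts_at A q"
  shows "c \<in> A" "q \<in> chart_dom c" "chart_map c q \<in> chart_map c ` chart_dom c"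
  using assms by (auto simp: charts_at_def)

lemma overlap_eq:
  assumes "c \<in> A" "d \<in> A"
  shows "chart_map c ` (chart_dom c \<inter> chart_dom d) =
    {x \<in> chart_map c ` chart_dom c. chart_inv c x \<in> chart_dom d}"
proof (intro set_eqI iffI)
  fix x assume "x \<in> chart_map c ` (chart_dom c \<inter> chart_dom d)"
  then obtain q where q: "q \<in> chart_dom c" "q \<in> chart_dom d" "x = chart_map c q" by blast
  then show "x \<in> {x \<in> chart_map c ` chart_dom c. chart_inv c x \<in> chart_dom d}"
    using chart_inv_map[OF assms(1) q(1)] by simp
next
  fix x assume "x \<in> {x \<in> chart_map c ` chart_dom c. chart_inv c x \<in> chart_dom d}"
  then obtain q where q: "q \<in> chart_dom c" "x = chart_map c q" "chart_inv c x \<in> chart_dom d" by blast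
  then show "x \<in> chart_map c ` (chart_dom c \<inter> chart_dom d)"
    using chart_inv_map[OF assms(1) q(1)] by simp
qed

lemma transition_has_derivative:
  assumes c: "c \<in> charts_at A q" and d: "d \<in> charts_at A q"
  shows "((chart_map d \<circ> chart_inv c) has_derivative
    frechet_derivative (chart_map d \<circ> chart_inv c) (at (chart_map c q))) (at (chart_map c q))"
proof (rule smooth_on_has_derivative)
  note cd = charts_atD[OF c] charts_atD[OF d]
  show "open (chart_map c ` (chart_dom c \<inter> chart_dom d))"
    unfolding overlap_eq[OF cd(1,4)]
    by (rule open_chart_inv_preimage[OF cd(1) open_chart_dom[OF cd(4)]])
  show "smooth_on (chart_map d \<circ> chart_inv c) (chart_map c ` (chart_dom c \<inter> chart_dom d))"
    by (rule smooth_transition[OF cd(1,4)])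
  show "chart_map c q \<in> chart_map c ` (chart_dom c \<inter> chart_dom d)"
    using cd by blast
qed

lemma frechet_derivative_transition_refl:
  assumes c: "c \<in> charts_at A q"
  shows "frechet_derivative (chart_map c \<circ> chart_inv c) (at (chart_map c q)) u = u"
proof -
  note c' = charts_atD[OF c]
  have "((chart_map c \<circ> chart_inv c) has_derivative (\<lambda>u. u)) (at (chart_map c q))"
    by (rule has_derivative_transform_within_open[OF has_derivative_ident open_chart_image[OF c'(1)] c'(3)])
      (simp add: chart_map_inv[OF c'(1)])
  from frechet_derivative_at[OF this, symmetric] show ?thesis by (rule fun_cong)
qed

lemma frechet_derivative_transition_trans:
  assumes c: "c \<in> charts_at A q" and d: "d \<in> charts_at A q" and e: "e \<in> charts_at A q"
  shows "frechet_derivative (chart_map e \<circ> chart_inv d) (at (chart_map d q))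
      (frechet_derivative (chart_map d \<circ> chart_inv c) (at (chart_map c q)) u) =
    frechet_derivative (chart_map e \<circ> chart_inv c) (at (chart_map c q)) u"
proof -
  note cd = charts_atD[OF c] charts_atD[OF d]
  let ?Dcd = "frechet_derivative (chart_map d \<circ> chart_inv c) (at (chart_map c q))"
  let ?Dde = "frechet_derivative (chart_map e \<circ> chart_inv d) (at (chart_map d q))"
  have "((chart_map e \<circ> chart_inv d) has_derivative ?Dde) (at ((chart_map d \<circ> chart_inv c) (chart_map c q)))"
    using transition_has_derivative[OF d e] by (simp add: chart_inv_map[OF cd(1,2)])
  from has_derivative_compose[OF transition_has_derivative[OF c d] this]
  have "((\<lambda>x. (chart_map e \<circ> chart_inv d) ((chart_map d \<circ> chart_inv c) x)) has_derivative
      (\<lambda>u. ?Dde (?Dcd u))) (at (chart_map c q))" .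
  then have "((chart_map e \<circ> chart_inv c) has_derivative (\<lambda>u. ?Dde (?Dcd u))) (at (chart_map c q))"
  proof (rule has_derivative_transform_within_open)
    show "open {x \<in> chart_map c ` chart_dom c. chart_inv c x \<in> chart_dom d}"
      by (rule open_chart_inv_preimage[OF cd(1) open_chart_dom[OF cd(4)]])
    show "chart_map c q \<in> {x \<in> chart_map c ` chart_dom c. chart_inv c x \<in> chart_dom d}"
      using cd chart_inv_map[OF cd(1,2)] by simp
    show "(chart_map e \<circ> chart_inv d) ((chart_map d \<circ> chart_inv c) x) = (chart_map e \<circ> chart_inv c) x"
      if "x \<in> {x \<in> chart_map c ` chart_dom c. chart_inv c x \<in> chart_dom d}" for x
      using that by (simp add: chart_inv_map[OF cd(4)])
  qed
  from frechet_derivative_at[OF this] show ?thesis by (rule fun_cong)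
qed

text \<open>The map \<open>coord_tvec A c q\<close> and the evaluation at \<open>c\<close> are mutually inverse linear maps between the
  model space and the tangent space at \<open>q\<close>. Through them, conditions on all tangent vectors become
  conditions on all vectors of the model space.\<close>

lemma coord_tvec_in_tangent_space:
  assumes "c \<in> charts_at A q"
  shows "coord_tvec A c q u \<in> tangent_space A q"
  unfolding tangent_space_def coord_tvec_def
  by (intro CollectI conjI ballI allI impI)
    (simp_all only: if_True if_False simp_thms frechet_derivative_transition_trans[OF assms])

lemma coord_tvec_component:
  assumes "v \<in> tangent_space A q" "c \<in> charts_at A q"
  shows "coord_tvec A c q (v c) = v"
proof
  fix d
  show "coord_tvec A c q (v c) d = v d"
  proof (cases "d \<in> charts_at A q")
    case True
    then have "v d = frechet_derivative (chart_map d \<circ> chart_inv c) (at (chart_map c q)) (v c)"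
      using assms unfolding tangent_space_def by blast
    with True show ?thesis by (simp only: coord_tvec_def if_True)
  next
    case False
    then have "v d = 0" using assms(1) unfolding tangent_space_def by blast
    with False show ?thesis by (simp only: coord_tvec_def if_False)
  qed
qed

lemma coord_tvec_self:
  assumes "c \<in> charts_at A q"
  shows "coord_tvec A c q u c = u"
  using assms by (simp add: coord_tvec_def frechet_derivative_transition_refl[OF assms])

lemma coord_tvec_linear:
  assumes "c \<in> charts_at A q"
  shows "coord_tvec A c q (a *\<^sub>R u + b *\<^sub>R v) =
    (\<lambda>d. a *\<^sub>R coord_tvec A c q u d + b *\<^sub>R coord_tvec A c q v d)"
proof
  fix d
  show "coord_tvec A c q (a *\<^sub>R u + b *\<^sub>R v) d = a *\<^sub>R coord_tvec A c q u d + b *\<^sub>R coord_tvec A c q v d"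
  proof (cases "d \<in> charts_at A q")
    case True
    have "linear (frechet_derivative (chart_map d \<circ> chart_inv c) (at (chart_map c q)))"
      using transition_has_derivative[OF assms True] by (rule has_derivative_linear)
    then show ?thesis
      using True by (simp add: coord_tvec_def linear_add linear_scale)
  qed (simp add: coord_tvec_def)
qed

lemma has_differential_map_ident:
  assumes W: "open W" "q \<in> W" and f: "\<And>q. q \<in> W \<Longrightarrow> f q = q"
  shows "has_differential_map A f q (\<lambda>v. v)"
  unfolding has_differential_map_def
proof (intro conjI ballI)
  have "((\<lambda>x. x) \<longlongrightarrow> q) (at q)" by (rule tendsto_ident_at)
  then have "(f \<longlongrightarrow> q) (at q)"
    by (rule Lim_transform_within_open[OF _ W]) (simp add: f)
  then show "isCont f q" unfolding isCont_def f[OF W(2)] .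
  show "v \<in> tangent_space A (f q)" if "v \<in> tangent_space A q" for v
    using that by (simp add: f[OF W(2)])
  fix c d assume c: "c \<in> charts_at A q" and d: "d \<in> charts_at A (f q)"
  note c' = charts_atD[OF c]
  have d: "d \<in> charts_at A q" using d by (simp add: f[OF W(2)])
  have "((chart_map d \<circ> f \<circ> chart_inv c) has_derivative
      frechet_derivative (chart_map d \<circ> chart_inv c) (at (chart_map c q))) (at (chart_map c q))"
  proof (rule has_derivative_transform_within_open[OF transition_has_derivative[OF c d]])
    show "open {x \<in> chart_map c ` chart_dom c. chart_inv c x \<in> W}"
      by (rule open_chart_inv_preimage[OF c'(1) W(1)])
    show "chart_map c q \<in> {x \<in> chart_map c ` chart_dom c. chart_inv c x \<in> W}"
      using c' W chart_inv_map[OF c'(1,2)] by simp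
  qed (auto simp: f)
  also have "frechet_derivative (chart_map d \<circ> chart_inv c) (at (chart_map c q)) = (\<lambda>u. coord_tvec A c q u d)"
    using d by (simp add: coord_tvec_def)
  finally show "((chart_map d \<circ> f \<circ> chart_inv c) has_derivative (\<lambda>u. coord_tvec A c q u d)) (at (chart_map c q))" .
qed

section \<open>Symplectic forms in a chart\<close>

context
  fixes \<omega> :: "('m, 'e) two_form" and c :: "('m, 'e) chart"
  assumes \<omega>: "symplectic_form A \<omega>" and c: "c \<in> A"
begin

abbreviation (input) V where "V \<equiv> chart_map c ` chart_dom c"

lemma chart_at_inv: "x \<in> V \<Longrightarrow> c \<in> charts_at A (chart_inv c x)"
  using c chart_inv_in[OF c] by (simp add: charts_at_def)

lemma two_form_skew:
  assumes "u \<in> tangent_space A q" "v \<in> tangent_space A q"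
  shows "\<omega> q u v = - \<omega> q v u"
proof -
  have "\<forall>q. \<forall>u\<in>tangent_space A q. \<forall>v\<in>tangent_space A q. \<omega> q u v = - \<omega> q v u"
    using \<omega> unfolding symplectic_form_def smooth_two_form_def by (elim conjE)
  from this[rule_format, OF assms] show ?thesis .
qed

lemma two_form_linear:
  assumes "u \<in> tangent_space A q" "v \<in> tangent_space A q" "w \<in> tangent_space A q"
  shows "\<omega> q (\<lambda>d. a *\<^sub>R u d + b *\<^sub>R v d) w = a * \<omega> q u w + b * \<omega> q v w"
proof -
  have "\<forall>q. \<forall>u\<in>tangent_space A q. \<forall>v\<in>tangent_space A q. \<forall>w\<in>tangent_space A q. \<forall>a b.
      \<omega> q (\<lambda>d. a *\<^sub>R u d + b *\<^sub>R v d) w = a * \<omega> q u w + b * \<omega> q v w"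
    using \<omega> unfolding symplectic_form_def smooth_two_form_def by (elim conjE)
  from this[rule_format, OF assms] show ?thesis .
qed

lemma coord_form_skew:
  assumes "x \<in> V"
  shows "coord_form A \<omega> c x u v = - coord_form A \<omega> c x v u"
  unfolding coord_form_def Let_def
  by (intro two_form_skew coord_tvec_in_tangent_space chart_at_inv assms)

lemma coord_form_linear:
  assumes "x \<in> V"
  shows "coord_form A \<omega> c x (a *\<^sub>R u + b *\<^sub>R v) w = a * coord_form A \<omega> c x u w + b * coord_form A \<omega> c x v w"
  unfolding coord_form_def Let_def coord_tvec_linear[OF chart_at_inv[OF assms]]
  by (intro two_form_linear coord_tvec_in_tangent_space chart_at_inv assms)

lemma coord_form_bilinear:
  assumes x: "x \<in> V"
  shows "bilinear (coord_form A \<omega> c x)"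
proof -
  have l: "linear (\<lambda>u. coord_form A \<omega> c x u w)" for w
  proof (rule linearI)
    show "coord_form A \<omega> c x (u + v) w = coord_form A \<omega> c x u w + coord_form A \<omega> c x v w" for u v
      using coord_form_linear[OF x, of 1 u 1 v w] by simp
    show "coord_form A \<omega> c x (a *\<^sub>R u) w = a *\<^sub>R coord_form A \<omega> c x u w" for a u
      using coord_form_linear[OF x, of a u 0 0 w] by simp
  qed
  moreover have "linear (\<lambda>w. coord_form A \<omega> c x u w)" for u
    unfolding coord_form_skew[OF x, of u] by (rule linear_compose_neg[OF l])
  ultimately show ?thesis by (simp add: bilinear_def)
qed

lemma coord_form_nondegenerate:
  assumes x: "x \<in> V" and 0: "\<And>v. coord_form A \<omega> c x u v = 0"
  shows "u = 0"
proof -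
  let ?q = "chart_inv c x"
  note cq = chart_at_inv[OF x]
  have "\<omega> ?q (coord_tvec A c ?q u) w = 0" if "w \<in> tangent_space A ?q" for w
    using 0[of "w c"] unfolding coord_form_def Let_def coord_tvec_component[OF that cq] .
  then have "coord_tvec A c ?q u = (\<lambda>_. 0)"
    using \<omega> coord_tvec_in_tangent_space[OF cq, of u]
    unfolding symplectic_form_def nondegenerate_two_form_def by blast
  then show "u = 0" using coord_tvec_self[OF cq, of u] by simp
qed

lemma coord_form_smooth: "smooth_on (\<lambda>x. coord_form A \<omega> c x u v) V"
  using \<omega> c unfolding symplectic_form_def smooth_two_form_def by blast

abbreviation (input) "D\<Omega> x w u v \<equiv> frechet_derivative (\<lambda>y. coord_form A \<omega> c y u v) (at x) w"

lemma coord_form_has_derivative: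
  "x \<in> V \<Longrightarrow> ((\<lambda>y. coord_form A \<omega> c y u v) has_derivative (\<lambda>w. D\<Omega> x w u v)) (at x)"
  using smooth_on_has_derivative[OF open_chart_image[OF c] coord_form_smooth] .

lemma coord_form_derivative_continuous: "continuous_on V (\<lambda>x. D\<Omega> x w u v)"
  by (rule smooth_on_imp_continuous_on[OF smooth_on_frechet_derivative[OF open_chart_image[OF c] coord_form_smooth]])

lemma coord_form_derivative_skew:
  assumes x: "x \<in> V"
  shows "D\<Omega> x w u v = - D\<Omega> x w v u"
proof -
  have "((\<lambda>y. coord_form A \<omega> c y u v) has_derivative (\<lambda>w. - D\<Omega> x w v u)) (at x)"
    by (rule has_derivative_transform_within_open[OF has_derivative_minus[OF coord_form_has_derivative[OF x]]
          open_chart_image[OF c] x])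
      (rule coord_form_skew[symmetric])
  from has_derivative_unique[OF coord_form_has_derivative[OF x] this] show ?thesis by (rule fun_cong)
qed

lemma coord_form_derivative_linear:
  assumes x: "x \<in> V"
  shows "D\<Omega> x w (a *\<^sub>R u + b *\<^sub>R u') v = a * D\<Omega> x w u v + b * D\<Omega> x w u' v"
proof -
  have "((\<lambda>y. a * coord_form A \<omega> c y u v + b * coord_form A \<omega> c y u' v) has_derivative
      (\<lambda>w. a * D\<Omega> x w u v + b * D\<Omega> x w u' v)) (at x)"
    by (intro has_derivative_add has_derivative_mult_right coord_form_has_derivative x)
  then have "((\<lambda>y. coord_form A \<omega> c y (a *\<^sub>R u + b *\<^sub>R u') v) has_derivative
      (\<lambda>w. a * D\<Omega> x w u v + b * D\<Omega> x w u' v)) (at x)"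
    by (rule has_derivative_transform_within_open[OF _ open_chart_image[OF c] x])
      (rule coord_form_linear[symmetric])
  from has_derivative_unique[OF coord_form_has_derivative[OF x] this] show ?thesis by (rule fun_cong)
qed

lemma coord_form_derivative_bilinear:
  assumes x: "x \<in> V"
  shows "bilinear (D\<Omega> x w)"
proof -
  have l: "linear (\<lambda>u. D\<Omega> x w u v)" for v
  proof (rule linearI)
    show "D\<Omega> x w (u + u') v = D\<Omega> x w u v + D\<Omega> x w u' v" for u u'
      using coord_form_derivative_linear[OF x, of 1 u 1 u' v w] by (simp only: scaleR_one mult_1_left)
    show "D\<Omega> x w (a *\<^sub>R u) v = a *\<^sub>R D\<Omega> x w u v" for a u
      using coord_form_derivative_linear[OF x, of a u 0 0 v w]
      by (simp only: scaleR_zero_left add_0_right mult_zero_left real_scaleR_def)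
  qed
  have "linear (\<lambda>v. D\<Omega> x w u v)" for u
  proof -
    have "(\<lambda>v. D\<Omega> x w u v) = (\<lambda>v. - D\<Omega> x w v u)"
      by (rule ext) (rule coord_form_derivative_skew[OF x])
    then show ?thesis by (simp only: linear_compose_neg[OF l])
  qed
  with l show ?thesis unfolding bilinear_def by blast
qed

lemma coord_form_closed:
  "x \<in> V \<Longrightarrow> D\<Omega> x u v w + D\<Omega> x v w u + D\<Omega> x w u v = 0"
proof -
  have "closed_two_form A \<omega>" using \<omega> by (simp add: symplectic_form_def)
  from this[unfolded closed_two_form_def, rule_format, OF c]
  show "x \<in> V \<Longrightarrow> D\<Omega> x u v w + D\<Omega> x v w u + D\<Omega> x w u v = 0" .
qed

end

section \<open>Rigidity at a degenerate maximum\<close>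

text \<open>This transports the estimates for \<open>hamiltonian_loops\<close> to the manifold. The work consists in
  choosing a ball on which all coordinate expressions are controlled, and in showing that orbits that start
  close enough to \<open>x\<^sub>0\<close> remain in the chart.\<close>

lemma loop_constant_near_degenerate_max:
  assumes \<omega>: "symplectic_form A \<omega>" and H: "smooth_family A H" and flow: "hamiltonian_flow A \<omega> H \<phi>"
    and loop: "is_loop \<phi>" and max: "fixed_local_max H x\<^sub>0" and deg: "totally_degenerate A \<phi> x\<^sub>0"
  shows "\<exists>W. open W \<and> x\<^sub>0 \<in> W \<and> (\<forall>q\<in>W. \<forall>t\<in>{0..1}. \<phi> t q = q \<and> H t q = H t x\<^sub>0)"
proof -
  from flow obtain Y where Y: "\<forall>t\<in>{0..1}. hamiltonian_vector_field A \<omega> (H t) (Y t)" and fl: "flow_of A Y \<phi>"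
    unfolding hamiltonian_flow_def by (elim exE conjE)
  have \<phi>_0: "\<phi> 0 q = q" for q using fl by (simp add: flow_of_def)
  have \<phi>_vel: "has_velocity A (\<lambda>s. \<phi> s q) (Y t (\<phi> t q)) t {0..1}" if "t \<in> {0..1}" for t q
    using fl that by (simp add: flow_of_def)
  from max obtain U where U: "open U" "x\<^sub>0 \<in> U" "\<forall>t\<in>{0..1}. \<forall>y\<in>U. H t y \<le> H t x\<^sub>0"
    unfolding fixed_local_max_def by (elim exE conjE)
  obtain c where cx: "c \<in> charts_at A x\<^sub>0" using chart_at by blast
  note c = charts_atD(1)[OF cx] and x0 = charts_atD(2)[OF cx]
  define V where "V = chart_map c ` chart_dom c"
  define p where "p = chart_map c x\<^sub>0"
  have inv_p: "chart_inv c p = x\<^sub>0" unfolding p_def by (rule chart_inv_map[OF c x0])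
  have V_open: "open V" unfolding V_def by (rule open_chart_image[OF c])
  have V_in: "chart_inv c x \<in> chart_dom c" "c \<in> charts_at A (chart_inv c x)" "chart_map c (chart_inv c x) = x"
    if "x \<in> V" for x
    using that c chart_inv_in[OF c] chart_map_inv[OF c] by (auto simp: V_def charts_at_def)
  have "open {x \<in> V. chart_inv c x \<in> U}"
    unfolding V_def by (rule open_chart_inv_preimage[OF c U(1)])
  moreover have "p \<in> {x \<in> V. chart_inv c x \<in> U}"
    using x0 U(2) inv_p by (simp add: V_def p_def)
  ultimately obtain R where "R > 0" and R: "cball p R \<subseteq> {x \<in> V. chart_inv c x \<in> U}"
    unfolding open_contains_cball by blast
  define \<Omega> where "\<Omega> = coord_form A \<omega> c"
  define D\<Omega> where "D\<Omega> x w u v = frechet_derivative (\<lambda>y. \<Omega> y u v) (at x) w" for x w u v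
  have RV: "x \<in> V" if "x \<in> cball p R" for x using R that by blast
  have \<Omega>_cont: "continuous_on V (\<lambda>x. \<Omega> x u v)" for u v
    unfolding \<Omega>_def V_def by (rule smooth_on_imp_continuous_on[OF coord_form_smooth[OF \<omega> c]])
  have "p \<in> V" using \<open>R > 0\<close> by (intro RV) simp
  obtain r C where r: "0 < r" "r \<le> R" and C: "0 \<le> C"
    "\<And>x u m. x \<in> cball p r \<Longrightarrow> (\<And>v. \<Omega> x u v \<le> m * norm v) \<Longrightarrow> norm u \<le> C * m"
  proof (rule nondegenerate_imp_coercive[OF \<open>R > 0\<close>, of p \<Omega>])
    show "bilinear (\<Omega> x)" if "x \<in> cball p R" for x
      using coord_form_bilinear[OF \<omega> c] RV[OF that] by (simp add: \<Omega>_def V_def)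
    show "continuous_on (cball p R) (\<lambda>x. \<Omega> x u v)" for u v
      by (rule continuous_on_subset[OF \<Omega>_cont]) (use RV in blast)
    show "u = 0" if "\<And>v. \<Omega> p u v = 0" for u
      using coord_form_nondegenerate[OF \<omega> c, of p u] that \<open>p \<in> V\<close> by (simp add: \<Omega>_def V_def)
  qed blast
  let ?K = "cball p r"
  have KV: "x \<in> V" if "x \<in> ?K" for x using RV that r by auto
  have KU: "chart_inv c x \<in> U" if "x \<in> ?K" for x
  proof -
    have "x \<in> cball p R" using that r by simp
    then show ?thesis using R by blast
  qed
  have sub: "?K \<subseteq> V" using KV by blast
  have p_in: "p \<in> ?K" using r by simp
  have bil: "bilinear (\<Omega> x)" if "x \<in> ?K" for x
    using coord_form_bilinear[OF \<omega> c] KV[OF that] by (simp add: \<Omega>_def V_def)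
  have skew: "\<Omega> x u v = - \<Omega> x v u" if "x \<in> ?K" for x u v
    using KV[OF that] unfolding \<Omega>_def V_def by (rule coord_form_skew[OF \<omega> c])
  have der: "((\<lambda>y. \<Omega> y u v) has_derivative (\<lambda>w. D\<Omega> x w u v)) (at x within ?K)" if "x \<in> ?K" for x u v
    using coord_form_has_derivative[OF \<omega> c] KV[OF that]
    by (auto simp: \<Omega>_def D\<Omega>_def V_def intro: has_derivative_at_withinI)
  have D\<Omega>_cont: "continuous_on ?K (\<lambda>x. D\<Omega> x w u v)" for w u v
    using continuous_on_subset[OF coord_form_derivative_continuous[OF \<omega> c, folded V_def] sub]
    by (simp add: \<Omega>_def D\<Omega>_def)
  have D\<Omega>_bil: "bilinear (D\<Omega> x w)" if "x \<in> ?K" for x w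
    using KV[OF that] unfolding \<Omega>_def D\<Omega>_def V_def by (rule coord_form_derivative_bilinear[OF \<omega> c])
  have D\<Omega>_skew: "D\<Omega> x w u v = - D\<Omega> x w v u" if "x \<in> ?K" for x w u v
    using KV[OF that] unfolding \<Omega>_def D\<Omega>_def V_def by (rule coord_form_derivative_skew[OF \<omega> c])
  have D\<Omega>_closed: "D\<Omega> x u v w + D\<Omega> x v w u + D\<Omega> x w u v = 0" if "x \<in> ?K" for x u v w
    using KV[OF that] unfolding \<Omega>_def D\<Omega>_def V_def by (rule coord_form_closed[OF \<omega> c])
  have "\<exists>lam Dlam. (\<forall>x\<in>?K. (lam has_derivative Dlam x) (at x within ?K)) \<and>
      (\<forall>u. continuous_on ?K (\<lambda>x. Dlam x u)) \<and>
      (\<forall>x\<in>?K. \<forall>u v. Dlam x u \<bullet> v - Dlam x v \<bullet> u = \<Omega> x u v)"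
    by (rule poincare_two_form[OF compact_cball convex_cball p_in bil der skew D\<Omega>_bil D\<Omega>_skew D\<Omega>_cont D\<Omega>_closed])
  then obtain lam Dlam where lam:
    "\<forall>x\<in>?K. (lam has_derivative Dlam x) (at x within ?K)"
    "\<forall>u. continuous_on ?K (\<lambda>x. Dlam x u)"
    "\<forall>x\<in>?K. \<forall>u v. Dlam x u \<bullet> v - Dlam x v \<bullet> u = \<Omega> x u v"
    by (elim exE conjE)
  obtain \<kappa> where \<kappa>: "0 \<le> \<kappa>" "\<And>x y u v. x \<in> ?K \<Longrightarrow> y \<in> ?K \<Longrightarrow>
      \<bar>\<Omega> x u v - \<Omega> y u v\<bar> \<le> \<kappa> * norm (x - y) * norm u * norm v"
    using bilinear_family_lipschitz[OF compact_cball convex_cball bil der D\<Omega>_cont] by blast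
  define h where "h t x = H t (chart_inv c x)" for t x
  define G where "G t x = (\<Sum>i\<in>Basis. frechet_derivative (h t) (at x) i *\<^sub>R i)" for t x
  define D where "D t x u = (\<Sum>i\<in>Basis. frechet_derivative (\<lambda>y. frechet_derivative (h t) (at y) i) (at x) u *\<^sub>R i)" for t x u
  define X where "X t x = Y t (chart_inv c x) c" for t x
  have h_smooth: "smooth_on (\<lambda>(t, x). h t x) ({0..1} \<times> V)"
    using H c unfolding smooth_family_def h_def V_def by blast
  have dh_smooth: "smooth_on (\<lambda>(t, x). frechet_derivative (h t) (at x) u) ({0..1} \<times> V)" for u
    using smooth_on_partial_frechet_derivative[OF V_open h_smooth, of u] by simp
  have h_der: "(h t has_derivative frechet_derivative (h t) (at x)) (at x)" if "t \<in> {0..1}" "x \<in> V" for t x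
    using smooth_on_has_partial_derivative[OF V_open h_smooth that] by simp
  have G: "G t x \<bullet> u = frechet_derivative (h t) (at x) u" if "t \<in> {0..1}" "x \<in> V" for t x u
  proof -
    have l: "linear (frechet_derivative (h t) (at x))"
      using h_der[OF that] by (rule has_derivative_linear)
    show ?thesis
      using linear_sum[OF l, of "\<lambda>i. (u \<bullet> i) *\<^sub>R i" Basis] linear_scale[OF l]
      by (simp add: G_def euclidean_representation inner_sum_left inner_sum_right inner_commute[of _ u] mult.commute)
  qed
  have G_der: "(G t has_derivative D t x) (at x)" if "t \<in> {0..1}" "x \<in> V" for t x
    using smooth_on_has_partial_derivative[OF V_open dh_smooth that]
    unfolding G_def[abs_def] D_def[abs_def]
    by (intro has_derivative_sum has_derivative_scaleR_left) simp
  have G_cont: "continuous_on ({0..1} \<times> V) (\<lambda>(t, x). G t x)"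
    using smooth_on_imp_continuous_on[OF dh_smooth] unfolding G_def case_prod_beta
    by (intro continuous_intros)
  have D_cont: "continuous_on ({0..1} \<times> V) (\<lambda>(t, x). D t x u)" for u
    using smooth_on_imp_continuous_on[OF smooth_on_partial_frechet_derivative[OF V_open dh_smooth]]
    unfolding D_def case_prod_beta by (intro continuous_intros) simp
  have prod_sub: "{0..1} \<times> ?K \<subseteq> {0..1::real} \<times> V" using sub by auto
  have X: "\<Omega> x (X t x) v = G t x \<bullet> v" if t: "t \<in> {0..1}" and x: "x \<in> V" for t x v
  proof -
    let ?q = "chart_inv c x"
    have Yq: "Y t ?q \<in> tangent_space A ?q" "has_differential_fun A (H t) ?q (\<omega> ?q (Y t ?q))"
      using bspec[OF Y t] unfolding hamiltonian_vector_field_def by blast+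
    have "(h t has_derivative (\<lambda>u. \<omega> ?q (Y t ?q) (coord_tvec A c ?q u))) (at x)"
      using Yq(2) V_in(2)[OF x] V_in(3)[OF x]
      unfolding has_differential_fun_def o_def h_def[abs_def] by force
    from has_derivative_unique[OF h_der[OF t x] this]
    have "frechet_derivative (h t) (at x) v = \<omega> ?q (Y t ?q) (coord_tvec A c ?q v)" by (rule fun_cong)
    also have "\<dots> = \<Omega> x (X t x) v"
      using coord_tvec_component[OF Yq(1) V_in(2)[OF x]] by (simp add: \<Omega>_def coord_form_def X_def Let_def)
    finally show ?thesis using G[OF t x] by simp
  qed
  interpret ball: hamiltonian_ball p r \<Omega> lam Dlam C \<kappa> h G D X
  proof
    show "0 < r" by (rule r(1))
    show "bilinear (\<Omega> x)" if "x \<in> ?K" for x by (rule bil[OF that])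
    show "\<Omega> x u v = - \<Omega> x v u" if "x \<in> ?K" for x u v by (rule skew[OF that])
    show "norm u \<le> C * m" if "x \<in> ?K" "\<And>v. \<Omega> x u v \<le> m * norm v" for x u m by (rule C(2)[OF that])
    show "\<bar>\<Omega> x u v - \<Omega> y u v\<bar> \<le> \<kappa> * norm (x - y) * norm u * norm v" if "x \<in> ?K" "y \<in> ?K" for x y u v
      by (rule \<kappa>(2)[OF that])
    show "0 \<le> C" "0 \<le> \<kappa>" by (rule C(1), rule \<kappa>(1))
    show "(lam has_derivative Dlam x) (at x within ?K)" if "x \<in> ?K" for x by (rule lam(1)[rule_format, OF that])
    show "continuous_on ?K (\<lambda>x. Dlam x u)" for u by (rule lam(2)[rule_format])
    show "Dlam x u \<bullet> v - Dlam x v \<bullet> u = \<Omega> x u v" if "x \<in> ?K" for x u v by (rule lam(3)[rule_format, OF that])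
    show "(h t has_derivative (\<lambda>u. G t x \<bullet> u)) (at x within ?K)" if "t \<in> {0..1}" "x \<in> ?K" for t x
      using h_der[OF that(1) KV[OF that(2)]] G[OF that(1) KV[OF that(2)]] by (simp add: has_derivative_at_withinI)
    show "(G t has_derivative D t x) (at x within ?K)" if "t \<in> {0..1}" "x \<in> ?K" for t x
      using G_der[OF that(1) KV[OF that(2)]] by (rule has_derivative_at_withinI)
    show "continuous_on ({0..1} \<times> ?K) (\<lambda>(t, x). h t x)"
      by (rule continuous_on_subset[OF smooth_on_imp_continuous_on[OF h_smooth] prod_sub])
    show "continuous_on ({0..1} \<times> ?K) (\<lambda>(t, x). G t x)"
      by (rule continuous_on_subset[OF G_cont prod_sub])
    show "continuous_on ({0..1} \<times> ?K) (\<lambda>(t, x). D t x u)" for u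
      by (rule continuous_on_subset[OF D_cont prod_sub])
    show "\<Omega> x (X t x) v = G t x \<bullet> v" if "t \<in> {0..1}" "x \<in> ?K" for t x v
      by (rule X[OF that(1) KV[OF that(2)]])
    show "h t x \<le> h t p" if "t \<in> {0..1}" "x \<in> ?K" for t x
      using U(3)[rule_format, OF that(1) KU[OF that(2)]] by (simp add: h_def inv_p)
  qed
  obtain L where L: "L \<ge> 0"
    "\<And>t x y. t \<in> {0..1} \<Longrightarrow> x \<in> ?K \<Longrightarrow> y \<in> ?K \<Longrightarrow> norm (X t x - X t y) \<le> L * norm (x - y)"
    using ball.X_lipschitz by blast
  \<comment> \<open>An orbit that starts within \<open>\<delta>\<close> of \<open>p\<close> grows at most by the factor \<open>exp L\<close> during the unit of time,
    so it remains in the closed ball of half the radius.\<close>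
  define \<delta> where "\<delta> = r / (2 * exp L)"
  have \<delta>: "0 < \<delta>" "exp L * \<delta> = r / 2" using r by (simp_all add: \<delta>_def)
  have "1 * \<delta> \<le> exp L * \<delta>" using L(1) \<delta>(1) by (intro mult_right_mono) auto
  then have \<delta>_le: "\<delta> \<le> r" using \<delta>(2) r(1) by linarith
  define \<Gamma> where "\<Gamma> x t = chart_map c (\<phi> t (chart_inv c x))" for x t
  have \<phi>_cont: "continuous_on {0..1} (\<lambda>t. \<phi> t q)" for q
    using \<phi>_vel unfolding has_velocity_def continuous_on_eq_continuous_within by blast
  have \<Gamma>_der: "(\<Gamma> x has_vector_derivative X t (\<Gamma> x t)) (at t within {0..1})"
    if t: "t \<in> {0..1}" and dom: "\<phi> t (chart_inv c x) \<in> chart_dom c" for x t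
  proof -
    have "c \<in> charts_at A (\<phi> t (chart_inv c x))" using c dom by (simp add: charts_at_def)
    then have "((chart_map c \<circ> (\<lambda>s. \<phi> s (chart_inv c x))) has_vector_derivative Y t (\<phi> t (chart_inv c x)) c) (at t within {0..1})"
      using \<phi>_vel[OF t, of "chart_inv c x"] unfolding has_velocity_def by blast
    then show ?thesis
      using chart_inv_map[OF c dom] by (simp add: o_def \<Gamma>_def[abs_def] X_def)
  qed
  define B where "B = {q \<in> chart_dom c. chart_map c q \<in> ball p r}"
  have B_open: "open B" unfolding B_def by (rule open_chart_map_preimage[OF c open_ball])
  have confined: "\<phi> t (chart_inv c x) \<in> B" if x: "x \<in> ball p \<delta>" and t: "t \<in> {0..1}" for x t
  proof (rule stays_inside[OF \<phi>_cont B_open _ _ _ _ t])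
    have xr: "x \<in> ball p r" using x \<delta>_le by simp
    then have "x \<in> V" by (intro KV) simp
    then show "\<phi> 0 (chart_inv c x) \<in> B"
      using V_in[of x] xr by (simp add: \<phi>_0 B_def)
    let ?C = "chart_inv c ` cball p (r / 2)"
    have halfV: "cball p (r / 2) \<subseteq> V" using KV r by auto
    show "closed ?C"
      by (intro compact_imp_closed compact_continuous_image compact_cball
          continuous_on_subset[OF chart_inv_cont[OF c, folded V_def] halfV])
    show "?C \<subseteq> B"
    proof
      fix q assume "q \<in> ?C"
      then obtain y where y: "y \<in> cball p (r / 2)" "q = chart_inv c y" by blast
      then have "y \<in> V" "y \<in> ball p r" using halfV r by auto
      then show "q \<in> B" using V_in[of y] y(2) by (simp add: B_def)
    qed
    fix t :: real assume t: "t \<in> {0..1}" and inside: "(\<lambda>t. \<phi> t (chart_inv c x)) ` {0..t} \<subseteq> B"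
    have sub_t: "{0..t} \<subseteq> {0..1}" using t by auto
    have in_B: "\<phi> s (chart_inv c x) \<in> chart_dom c" "\<Gamma> x s \<in> ball p r" if "s \<in> {0..t}" for s
    proof -
      have "\<phi> s (chart_inv c x) \<in> B" using inside that by blast
      then show "\<phi> s (chart_inv c x) \<in> chart_dom c" "\<Gamma> x s \<in> ball p r"
        by (simp_all add: B_def \<Gamma>_def)
    qed
    have "norm (\<Gamma> x t - p) \<le> exp (L * t) * norm (\<Gamma> x 0 - p)"
    proof (rule norm_le_exp_mult_norm[where b = t])
      fix s assume s: "s \<in> {0..t}"
      then have s1: "s \<in> {0..1}" using sub_t by auto
      have "((\<lambda>s. \<Gamma> x s - p) has_vector_derivative X s (\<Gamma> x s) - 0) (at s within {0..t})"
        by (intro has_vector_derivative_diff has_vector_derivative_const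
            has_vector_derivative_within_subset[OF \<Gamma>_der[OF s1 in_B(1)[OF s]] sub_t])
      then show "((\<lambda>s. \<Gamma> x s - p) has_vector_derivative X s (\<Gamma> x s)) (at s within {0..t})" by simp
      show "norm (X s (\<Gamma> x s)) \<le> L * norm (\<Gamma> x s - p)"
        using L(2)[OF s1 _ p_in, of "\<Gamma> x s"] in_B(2)[OF s] ball.X_p[OF s1] by simp
    qed (use t in simp)
    also have "\<dots> \<le> exp L * \<delta>"
    proof (rule mult_mono)
      show "exp (L * t) \<le> exp L" using t L(1) by (simp add: mult_left_le)
      have "\<Gamma> x 0 = x" using V_in(3)[OF \<open>x \<in> V\<close>] by (simp add: \<Gamma>_def \<phi>_0)
      then show "norm (\<Gamma> x 0 - p) \<le> \<delta>" using x by (simp add: dist_norm norm_minus_commute)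
    qed simp_all
    finally have "\<Gamma> x t \<in> cball p (r / 2)" using \<delta>(2) by (simp add: dist_norm norm_minus_commute)
    moreover have "\<phi> t (chart_inv c x) = chart_inv c (\<Gamma> x t)"
      using chart_inv_map[OF c in_B(1)[of t]] t by (simp add: \<Gamma>_def)
    ultimately show "\<phi> t (chart_inv c x) \<in> ?C" by blast
  qed
  have \<delta>_V: "x \<in> V" if "x \<in> ball p \<delta>" for x
    using that \<delta>_le by (intro KV) auto
  interpret loops: hamiltonian_loops p r \<Omega> lam Dlam C \<kappa> h G D X L \<delta> \<Gamma>
  proof
    show "norm (X t x - X t y) \<le> L * norm (x - y)" if "t \<in> {0..1}" "x \<in> ?K" "y \<in> ?K" for t x y
      by (rule L(2)[OF that])
    show "0 \<le> L" "0 < \<delta>" by (rule L(1), rule \<delta>(1))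
    fix x and t :: real assume x: "x \<in> ball p \<delta>"
    show "\<Gamma> x 0 = x" using V_in(3)[OF \<delta>_V[OF x]] by (simp add: \<Gamma>_def \<phi>_0)
    show "\<Gamma> x 1 = x" using V_in(3)[OF \<delta>_V[OF x]] loop by (simp add: \<Gamma>_def is_loop_def)
    assume t: "t \<in> {0..1}"
    show "\<Gamma> x t \<in> ?K" using confined[OF x t] by (simp add: B_def \<Gamma>_def)
    show "(\<Gamma> x has_vector_derivative X t (\<Gamma> x t)) (at t within {0..1})"
      using confined[OF x t] by (intro \<Gamma>_der[OF t]) (simp add: B_def)
  next
    fix t :: real assume t: "t \<in> {0..1}"
    have "\<phi> t x\<^sub>0 = x\<^sub>0" and "has_differential_map A (\<phi> t) x\<^sub>0 (\<lambda>v. v)"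
      using deg t unfolding totally_degenerate_def by blast+
    then have "((chart_map c \<circ> \<phi> t \<circ> chart_inv c) has_derivative (\<lambda>u. coord_tvec A c x\<^sub>0 u c)) (at p)"
      using cx unfolding has_differential_map_def p_def by simp
    then show "((\<lambda>x. \<Gamma> x t) has_derivative (\<lambda>u. u)) (at p)"
      by (simp add: coord_tvec_self[OF cx] o_def \<Gamma>_def)
  qed
  obtain \<rho> where "\<rho> > 0" and \<rho>: "\<And>x t. x \<in> ball p \<rho> \<Longrightarrow> t \<in> {0..1} \<Longrightarrow> \<Gamma> x t = x \<and> h t x = h t p"
    using loops.\<Gamma>_constant by blast
  define W where "W = {q \<in> chart_dom c. chart_map c q \<in> ball p (min \<rho> \<delta>)}"
  show ?thesis
  proof (intro exI[of _ W] conjI ballI)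
    show "open W" unfolding W_def by (rule open_chart_map_preimage[OF c open_ball])
    show "x\<^sub>0 \<in> W" using x0 \<open>\<rho> > 0\<close> \<delta> by (simp add: W_def p_def)
    fix q t assume q: "q \<in> W" and t: "t \<in> {0..1::real}"
    let ?x = "chart_map c q"
    have qx: "chart_inv c ?x = q" using q by (intro chart_inv_map[OF c]) (simp add: W_def)
    have x: "?x \<in> ball p \<rho>" "?x \<in> ball p \<delta>" using q by (auto simp: W_def)
    have "\<phi> t q \<in> chart_dom c" using confined[OF x(2) t] by (simp add: B_def qx)
    then have "chart_inv c (\<Gamma> ?x t) = \<phi> t q" using chart_inv_map[OF c] by (simp add: \<Gamma>_def qx)
    then show "\<phi> t q = q" using \<rho>[OF x(1) t] by (simp add: qx)
    show "H t q = H t x\<^sub>0" using \<rho>[OF x(1) t] by (simp add: h_def qx inv_p)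
  qed
qed

end

theorem theorem1p3:
  fixes A :: "('m::{t2_space,second_countable_topology}, 'e::euclidean_space) chart set"
    and \<omega> :: "('m, 'e) two_form"
    and H :: "real \<Rightarrow> 'm \<Rightarrow> real"
    and \<phi> :: "real \<Rightarrow> 'm \<Rightarrow> 'm"
  assumes "smooth_atlas A"
    and "compact (UNIV :: 'm set)"
    and "connected (UNIV :: 'm set)"
    and "symplectic_form A \<omega>"
    and "smooth_family A H"
    and "hamiltonian_flow A \<omega> H \<phi>"
    and "is_loop \<phi>"
  shows "open {x\<^sub>0. fixed_local_max H x\<^sub>0 \<and> totally_degenerate A \<phi> x\<^sub>0}"
proof (subst open_subopen, rule ballI)
  interpret smooth_manifold A by unfold_locales (rule assms(1))
  fix x\<^sub>0 assume "x\<^sub>0 \<in> {x\<^sub>0. fixed_local_max H x\<^sub>0 \<and> totally_degenerate A \<phi> x\<^sub>0}"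
  then have max: "fixed_local_max H x\<^sub>0" and deg: "totally_degenerate A \<phi> x\<^sub>0" by auto
  obtain W where W: "open W" "x\<^sub>0 \<in> W"
    and const: "\<forall>q\<in>W. \<forall>t\<in>{0..1}. \<phi> t q = q \<and> H t q = H t x\<^sub>0"
    using loop_constant_near_degenerate_max[OF assms(4-7) max deg] by (elim exE conjE)
  from max obtain U where U: "open U" "x\<^sub>0 \<in> U" "\<forall>t\<in>{0..1}. \<forall>y\<in>U. H t y \<le> H t x\<^sub>0"
    unfolding fixed_local_max_def by (elim exE conjE)
  have "fixed_local_max H q \<and> totally_degenerate A \<phi> q" if q: "q \<in> W \<inter> U" for q
  proof
    have "\<forall>t\<in>{0..1}. \<forall>y\<in>U. H t y \<le> H t q"
    proof (intro ballI)
      fix t :: real and y assume t: "t \<in> {0..1}" and y: "y \<in> U"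
      have "H t y \<le> H t x\<^sub>0" using U(3) t y by blast
      also have "H t x\<^sub>0 = H t q" using const q t by simp
      finally show "H t y \<le> H t q" .
    qed
    then show "fixed_local_max H q"
      unfolding fixed_local_max_def using q U(1) by blast
    show "totally_degenerate A \<phi> q"
      unfolding totally_degenerate_def
    proof (intro conjI ballI)
      fix t :: real assume t: "t \<in> {0..1}"
      show "\<phi> t q = q" using const q t by blast
      show "has_differential_map A (\<phi> t) q (\<lambda>v. v)"
        by (rule has_differential_map_ident[OF W(1)]) (use q const t in blast)+
    qed
  qed
  then show "\<exists>T. open T \<and> x\<^sub>0 \<in> T \<and> T \<subseteq> {x\<^sub>0. fixed_local_max H x\<^sub>0 \<and> totally_degenerate A \<phi> x\<^sub>0}"
    using W U by (intro exI[of _ "W \<inter> U"]) auto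
qed

end
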